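(* If $C$ is a closed convex curve in the plane with minimum halving distance $h$ and width $w$, then $h\ge w/2$. This bound is tight, i.e. the constant $1/2$ cannot be replaced by a larger one.
   Context: A closed convex curve is the boundary of a planar convex body. The width $w$ is the minimum distance between two parallel lines enclosing $C$. A halving pair of $C$ consists of two points $p,\hat p\in C$ dividing $C$ into two arcs of equal length; $h$ is the minimum of the Euclidean distance $|p\hat p|$ over all halving pairs. *)

theory Defs
  imports "HOL-Analysis.Analysis"
begin

definition closed_convex_curve :: "(real^2) set \<Rightarrow> bool" where
  "closed_convex_curve C \<longleftrightarrow>
     (\<exists>K. compact K \<and> convex K \<and> interior K \<noteq> {} \<and> C = frontier K)"

(* Supremum of the lengths of inscribed polygonal chains; infinity for a non-rectifiable path. *)
definition path_length :: "(real \<Rightarrow> 'a::metric_space) \<Rightarrow> ereal" where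
  "path_length g =
     (SUP ts\<in>{ts. sorted ts \<and> set ts \<subseteq> {0..1}}.
        ereal (\<Sum>i<length ts - 1. dist (g (ts ! i)) (g (ts ! Suc i))))"

(* For a unit vector u, the parallel lines {x. u \<bullet> x = a} and {x. u \<bullet> x = b} with a \<le> b
   are at distance b - a.  For a closed convex curve the infimum is attained. *)
definition curve_width :: "(real^2) set \<Rightarrow> real" where
  "curve_width C = Inf {b - a | u a b. norm u = 1 \<and> C \<subseteq> {x. a \<le> u \<bullet> x \<and> u \<bullet> x \<le> b}}"

(* g1 and g2 are injective, so p and q are distinct, and g1, g2 parametrize the two
   arcs into which p and q divide C. *)
definition halving_pair :: "(real^2) set \<Rightarrow> real^2 \<Rightarrow> real^2 \<Rightarrow> bool" where
  "halving_pair C p q \<longleftrightarrow>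
     (\<exists>g1 g2. arc g1 \<and> pathstart g1 = p \<and> pathfinish g1 = q \<and>
              arc g2 \<and> pathstart g2 = q \<and> pathfinish g2 = p \<and>
              path_image g1 \<union> path_image g2 = C \<and>
              path_image g1 \<inter> path_image g2 = {p, q} \<and>
              path_length g1 = path_length g2)"

(* For a closed convex curve, halving pairs exist and the infimum is attained. *)
definition min_halving_distance :: "(real^2) set \<Rightarrow> real" where
  "min_halving_distance C = Inf {dist p q | p q. halving_pair C p q}"

end

theory Submission
  imports Defs
begin

text \<open>Let \<open>p\<close>, \<open>q\<close> be a halving pair at distance \<open>d\<close>, with arcs of common length \<open>L\<close>, and consider
  supporting lines at \<open>p\<close> and \<open>q\<close>. If they are parallel, the width is at most \<open>d\<close>. Otherwise they meet in
  a point \<open>z\<close>; put \<open>a = |p - z|\<close>, \<open>b = |q - z|\<close> and let \<open>\<theta>\<close> be the angle at \<open>z\<close>. In the coordinates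
  along the two lines the arc facing \<open>z\<close> is monotone, so \<open>L \<le> a + b\<close>. Hence every point \<open>x\<close> of the curve
  satisfies \<open>|x - p| + |x - q| \<le> a + b\<close>: it lies in the ellipse with foci \<open>p\<close>, \<open>q\<close> through \<open>z\<close>, and
  therefore on the \<open>z\<close>-side of the tangent to this ellipse at \<open>p + q - z\<close>. Together with the supporting
  lines this tangent bounds an isosceles triangle with apex \<open>z\<close>, angle \<open>\<theta>\<close> and legs \<open>a + b\<close>. Its width
  is at most \<open>(a + b) sin \<theta> \<le> 2 (a + b) sin (\<theta>/2) \<le> 2 d\<close>.

  An isosceles triangle with base 2 and height tending to infinity shows that the constant is optimal:
  its width tends to 2, while the horizontal halving pair has distance tending to 1.\<close>

subsection \<open>Length of paths\<close>

definition chain_length :: "(real \<Rightarrow> 'a::metric_space) \<Rightarrow> real list \<Rightarrow> real" where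
  "chain_length g ts = (\<Sum>i<length ts - 1. dist (g (ts ! i)) (g (ts ! Suc i)))"

lemma chain_length_simps [simp]:
  "chain_length g [] = 0"
  "chain_length g [s] = 0"
  "chain_length g (s # t # ts) = dist (g s) (g t) + chain_length g (t # ts)"
  unfolding chain_length_def by (simp_all add: sum.lessThan_Suc_shift del: sum.lessThan_Suc)

lemma chain_length_map: "chain_length g (map f ts) = chain_length (g \<circ> f) ts"
  unfolding chain_length_def by (auto intro!: sum.cong)

lemma chain_length_cong:
  "(\<And>t. t \<in> set ts \<Longrightarrow> g t = h t) \<Longrightarrow> chain_length g ts = chain_length h ts"
  unfolding chain_length_def by (auto intro!: sum.cong)

text \<open>The triangle inequality at the seam: one edge of the chain is replaced by two edges
  through \<open>c\<close>. Later \<open>c\<close> is the parameter at which an interval is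
  cut.\<close>

lemma chain_length_append_le:
  "chain_length g (xs @ ys) \<le> chain_length g (xs @ [c]) + chain_length g (c # ys)"
proof (induction xs rule: induct_list012)
  case 1
  show ?case
    by (cases ys) auto
next
  case (2 x)
  show ?case
    using dist_triangle[of "g x" _ "g c"] by (cases ys) auto
qed auto

text \<open>The parameter interval is a variable so that additivity and rescaling can be stated. The
  empty chain keeps the index set of the supremum nonempty.\<close>

definition length_on :: "(real \<Rightarrow> 'a::metric_space) \<Rightarrow> real \<Rightarrow> real \<Rightarrow> ereal" where
  "length_on g a b = (SUP ts\<in>{ts. sorted ts \<and> set ts \<subseteq> {a..b}}. ereal (chain_length g ts))"

lemma path_length_eq: "path_length g = length_on g 0 1"
  unfolding path_length_def length_on_def chain_length_def ..

lemma chain_length_le_length_on: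
  "sorted ts \<Longrightarrow> set ts \<subseteq> {a..b} \<Longrightarrow> ereal (chain_length g ts) \<le> length_on g a b"
  unfolding length_on_def by (rule SUP_upper) auto

lemma length_on_leI:
  assumes "\<And>ts. sorted ts \<Longrightarrow> set ts \<subseteq> {a..b} \<Longrightarrow> ereal (chain_length g ts) \<le> L"
  shows "length_on g a b \<le> L"
  unfolding length_on_def by (rule SUP_least) (use assms in auto)

lemma length_on_nonneg: "0 \<le> length_on g a b"
  using chain_length_le_length_on[of "[]" a b g] by (simp add: zero_ereal_def)

lemma dist_le_length_on: "a \<le> b \<Longrightarrow> ereal (dist (g a) (g b)) \<le> length_on g a b"
  using chain_length_le_length_on[of "[a, b]" a b g] by simp

lemma length_on_cong:
  assumes "\<And>t. t \<in> {a..b} \<Longrightarrow> g t = h t"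
  shows "length_on g a b = length_on h a b"
  unfolding length_on_def
proof (rule SUP_cong)
  fix ts assume "ts \<in> {ts. sorted ts \<and> set ts \<subseteq> {a..b}}"
  then show "ereal (chain_length g ts) = ereal (chain_length h ts)"
    using assms chain_length_cong[of ts g h] by blast
qed simp

text \<open>Weakly monotone maps carry chains to chains, since sorted lists may repeat entries.
  Applied to an affine map and to its inverse, this gives invariance under rescaling.\<close>

lemma length_on_compose_le:
  assumes "mono_on {a..b} f" "f ` {a..b} \<subseteq> {c..d}"
  shows "length_on (g \<circ> f) a b \<le> length_on g c d"
proof (rule length_on_leI)
  fix ts assume ts: "sorted ts" "set ts \<subseteq> {a..b}"
  have "sorted (map f ts)"
    using ts assms(1) by (induction ts) (auto simp: mono_on_def)
  then show "ereal (chain_length (g \<circ> f) ts) \<le> length_on g c d"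
    using chain_length_le_length_on[of "map f ts" c d g] ts assms(2)
    by (auto simp: chain_length_map)
qed

lemma length_on_affine:
  assumes "m > 0"
  shows "length_on (\<lambda>t. g (m * t + e)) a b = length_on g (m * a + e) (m * b + e)"
proof (rule antisym)
  show "length_on (\<lambda>t. g (m * t + e)) a b \<le> length_on g (m * a + e) (m * b + e)"
  proof -
    have "mono_on {a..b} (\<lambda>t. m * t + e)"
      using assms by (auto simp: mono_on_def)
    moreover have "(\<lambda>t. m * t + e) ` {a..b} \<subseteq> {m * a + e..m * b + e}"
      using assms by auto
    ultimately show ?thesis
      using length_on_compose_le[of a b "\<lambda>t. m * t + e" "m * a + e" "m * b + e" g]
      by (simp add: o_def)
  qed
  have "length_on ((\<lambda>t. g (m * t + e)) \<circ> (\<lambda>s. (s - e) / m)) (m * a + e) (m * b + e)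
      \<le> length_on (\<lambda>t. g (m * t + e)) a b"
    by (rule length_on_compose_le) (use assms in \<open>auto simp: mono_on_def field_simps\<close>)
  then show "length_on g (m * a + e) (m * b + e) \<le> length_on (\<lambda>t. g (m * t + e)) a b"
    using assms by (simp add: o_def)
qed

lemma path_length_subpath:
  assumes "a < b"
  shows "path_length (subpath a b g) = length_on g a b"
  unfolding path_length_eq subpath_def
  using length_on_affine[of "b - a" g a 0 1] assms by simp

lemma chain_length_append_ge: "chain_length g xs + chain_length g ys \<le> chain_length g (xs @ ys)"
  by (induction xs rule: induct_list012; cases ys) auto

text \<open>Inserting \<open>b\<close> into a chain never shortens it, which gives one inequality.
  For the other, chains on both sides are concatenated.\<close>

lemma length_on_add:
  assumes "a \<le> b" "b \<le> c"
  shows "length_on g a c = length_on g a b + length_on g b c"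
proof (rule antisym)
  show "length_on g a c \<le> length_on g a b + length_on g b c"
  proof (rule length_on_leI)
    fix ts assume ts: "sorted ts" "set ts \<subseteq> {a..c}"
    define xs ys where "xs = takeWhile (\<lambda>t. t \<le> b) ts" and "ys = dropWhile (\<lambda>t. t \<le> b) ts"
    have split: "xs @ ys = ts"
      by (simp add: xs_def ys_def)
    have sorted: "sorted xs" "sorted ys"
      using ts(1) by (simp_all add: sorted_append flip: split)
    have xs: "x \<le> b" if "x \<in> set xs" for x
      using that unfolding xs_def by (blast dest: set_takeWhileD)
    have ys: "b \<le> y" if y: "y \<in> set ys" for y
    proof -
      obtain z zs where z: "ys = z # zs"
        using y by (cases ys) auto
      then have "\<not> z \<le> b"
        using hd_dropWhile[of "\<lambda>t. t \<le> b" ts] by (simp add: ys_def)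
      moreover have "z \<le> y"
        using y sorted(2) by (auto simp: z)
      ultimately show ?thesis
        by simp
    qed
    have "set xs \<union> set ys \<subseteq> {a..c}"
      using ts(2) by (simp flip: split)
    then have "sorted (xs @ [b])" "set (xs @ [b]) \<subseteq> {a..b}" "sorted (b # ys)" "set (b # ys) \<subseteq> {b..c}"
      using sorted xs ys assms by (auto simp: sorted_append)
    then have le: "ereal (chain_length g (xs @ [b])) + ereal (chain_length g (b # ys))
        \<le> length_on g a b + length_on g b c"
      by (intro add_mono chain_length_le_length_on)
    have "ereal (chain_length g ts)
        \<le> ereal (chain_length g (xs @ [b])) + ereal (chain_length g (b # ys))"
      using chain_length_append_le[of g xs ys b] unfolding split by simp
    with le show "ereal (chain_length g ts) \<le> length_on g a b + length_on g b c"
      by (rule order_trans[rotated])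
  qed
  let ?S = "\<lambda>a b. {ts. sorted ts \<and> set ts \<subseteq> {a..b :: real}}"
  have ne: "?S s t \<noteq> {}" for s t
  proof -
    have "[] \<in> ?S s t"
      by simp
    then show ?thesis
      by blast
  qed
  have *: "ereal (chain_length g xs) + ereal (chain_length g ys) \<le> length_on g a c"
    if "xs \<in> ?S a b" "ys \<in> ?S b c" for xs ys
  proof -
    have "\<forall>x\<in>set xs. \<forall>y\<in>set ys. x \<le> y"
      using that by fastforce
    moreover have "set (xs @ ys) \<subseteq> {a..c}"
      using that assms by fastforce
    ultimately have "ereal (chain_length g (xs @ ys)) \<le> length_on g a c"
      using that by (intro chain_length_le_length_on) (auto simp: sorted_append)
    moreover have "ereal (chain_length g xs) + ereal (chain_length g ys) \<le> ereal (chain_length g (xs @ ys))"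
      using chain_length_append_ge[of g xs ys] by simp
    ultimately show ?thesis
      by (rule order_trans[rotated])
  qed
  \<comment> \<open>The supremum over \<open>ys\<close> is taken first with \<open>xs\<close> fixed;
    the one over \<open>xs\<close> follows, where the constant summand must not be minus
    infinity.\<close>
  have "ereal (chain_length g xs) + length_on g b c \<le> length_on g a c" if "xs \<in> ?S a b" for xs
  proof -
    have "(SUP ys\<in>?S b c. ereal (chain_length g xs) + ereal (chain_length g ys)) \<le> length_on g a c"
      using *[OF that] by (rule SUP_least)
    then show ?thesis
      unfolding length_on_def[of g b c] by (subst (asm) SUP_ereal_add_right[OF ne]) auto
  qed
  moreover have "length_on g b c \<noteq> - \<infinity>"
    using length_on_nonneg[of g b c] by auto
  ultimately have "(SUP xs\<in>?S a b. ereal (chain_length g xs)) + length_on g b c \<le> length_on g a c"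
    by (subst SUP_ereal_add_left[OF ne, symmetric]) (auto intro: SUP_least)
  then show "length_on g a b + length_on g b c \<le> length_on g a c"
    unfolding length_on_def[of g a b] .
qed

text \<open>Telescoping: the bound forces \<open>\<phi>\<close> to be nondecreasing, and the edges
  of a chain add up to at most its total increment.\<close>

lemma length_on_le_sum_increments:
  fixes \<phi> :: "real \<Rightarrow> real"
  assumes "a \<le> b"
    and bound: "\<And>s t. a \<le> s \<Longrightarrow> s \<le> t \<Longrightarrow> t \<le> b \<Longrightarrow> dist (g s) (g t) \<le> \<phi> t - \<phi> s"
  shows "length_on g a b \<le> \<phi> b - \<phi> a"
proof (rule length_on_leI)
  have mono: "\<phi> s \<le> \<phi> t" if "a \<le> s" "s \<le> t" "t \<le> b" for s t
    using bound[OF that] zero_le_dist[of "g s" "g t"] by linarith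
  have chain: "chain_length g (t # ts) \<le> \<phi> b - \<phi> t"
    if "sorted (t # ts)" "set (t # ts) \<subseteq> {a..b}" for t ts
    using that
  proof (induction ts arbitrary: t)
    case Nil
    then show ?case
      using mono[of t b] by simp
  next
    case (Cons u us)
    have "chain_length g (u # us) \<le> \<phi> b - \<phi> u"
      using Cons.prems by (intro Cons.IH) auto
    moreover have "dist (g t) (g u) \<le> \<phi> u - \<phi> t"
      using Cons.prems by (intro bound) auto
    ultimately show ?case
      by simp
  qed
  fix ts assume ts: "sorted ts" "set ts \<subseteq> {a..b}"
  show "ereal (chain_length g ts) \<le> \<phi> b - \<phi> a"
  proof (cases ts)
    case Nil
    then show ?thesis
      using mono[of a b] assms(1) by simp
  next
    case (Cons u us)
    then show ?thesis
      using chain[of u us] mono[of a u] ts by simp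
  qed
qed

lemma length_on_le_Lipschitz:
  assumes "a \<le> b" "L-lipschitz_on {a..b} g"
  shows "length_on g a b \<le> L * (b - a)"
proof -
  have "dist (g s) (g t) \<le> L * t - L * s" if "a \<le> s" "s \<le> t" "t \<le> b" for s t
    using lipschitz_onD[OF assms(2), of s t] that by (simp add: dist_real_def right_diff_distrib)
  then show ?thesis
    using length_on_le_sum_increments[of a b g "\<lambda>t. L * t"] assms(1)
    by (simp add: right_diff_distrib)
qed

lemma path_length_join:
  assumes "pathfinish g1 = pathstart g2"
  shows "path_length (g1 +++ g2) = path_length g1 + path_length g2"
proof -
  have "length_on (g1 +++ g2) 0 (1/2) = length_on (\<lambda>t. g1 (2 * t + 0)) 0 (1/2)"
    by (rule length_on_cong) (auto simp: joinpaths_def)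
  also have "\<dots> = length_on g1 0 1"
    using length_on_affine[of 2 g1 0 0 "1/2"] by simp
  finally have 1: "length_on (g1 +++ g2) 0 (1/2) = length_on g1 0 1" .
  have "length_on (g1 +++ g2) (1/2) 1 = length_on (\<lambda>t. g2 (2 * t + (-1))) (1/2) 1"
  proof (rule length_on_cong)
    fix t :: real assume t: "t \<in> {1/2..1}"
    \<comment> \<open>At the junction \<open>joinpaths\<close> takes its value from
      \<open>g1\<close>, so the assumption on the endpoints identifies it with the start of
      \<open>g2\<close>.\<close>
    show "(g1 +++ g2) t = g2 (2 * t + (-1))"
    proof (cases "t = 1/2")
      case True
      show ?thesis
        using assms unfolding True by (simp add: joinpaths_def pathfinish_def pathstart_def)
    qed (use t in \<open>simp add: joinpaths_def\<close>)
  qed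
  also have "\<dots> = length_on g2 0 1"
    using length_on_affine[of 2 g2 "-1" "1/2" 1] by simp
  finally have 2: "length_on (g1 +++ g2) (1/2) 1 = length_on g2 0 1" .
  have "length_on (g1 +++ g2) 0 1 = length_on (g1 +++ g2) 0 (1/2) + length_on (g1 +++ g2) (1/2) 1"
    by (rule length_on_add) auto
  then show ?thesis
    unfolding path_length_eq 1 2 .
qed

lemma path_length_linepath: "path_length (linepath a b) = dist a b"
proof (rule antisym)
  have "dist (linepath a b s) (linepath a b t) = \<bar>s - t\<bar> * dist a b" for s t
  proof -
    have "linepath a b s - linepath a b t = (s - t) *\<^sub>R (b - a)"
      by (simp add: linepath_def algebra_simps)
    then show ?thesis
      by (simp add: dist_norm norm_minus_commute)
  qed
  then show "path_length (linepath a b) \<le> dist a b"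
    unfolding path_length_eq using length_on_le_Lipschitz[of 0 1 "dist a b" "linepath a b"]
    by (simp add: lipschitz_on_def dist_real_def mult.commute)
  show "dist a b \<le> path_length (linepath a b)"
    unfolding path_length_eq using dist_le_length_on[of 0 1 "linepath a b"]
    by (simp add: linepath_def)
qed

text \<open>Compares with the chain whose only inner vertex is \<open>x\<close>. A length bound for
  an arc thus becomes an ellipse condition with foci at its endpoints.\<close>

lemma dist_sum_le_path_length:
  assumes "x \<in> path_image g"
  shows "ereal (dist (pathstart g) x + dist x (pathfinish g)) \<le> path_length g"
proof -
  obtain t where "t \<in> {0..1}" "x = g t"
    using assms by (auto simp: path_image_def)
  then show ?thesis
    unfolding path_length_eq pathstart_def pathfinish_def
    using chain_length_le_length_on[of "[0, t, 1]" 0 1 g] by simp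
qed

text \<open>The bound makes \<open>\<phi> \<circ> g\<close> injective. Being continuous on an
  interval, it is then strictly monotone, and its increments telescope.\<close>

lemma arc_length_le_increment:
  fixes g :: "real \<Rightarrow> 'a::metric_space" and \<phi> :: "'a \<Rightarrow> real"
  assumes "path g" "inj_on g {0..1}" "continuous_on (path_image g) \<phi>"
    and bound: "\<And>x y. x \<in> path_image g \<Longrightarrow> y \<in> path_image g \<Longrightarrow> dist x y \<le> \<bar>\<phi> x - \<phi> y\<bar>"
  shows "path_length g \<le> \<bar>\<phi> (pathstart g) - \<phi> (pathfinish g)\<bar>"
proof -
  have bound': "dist (g s) (g t) \<le> \<bar>\<phi> (g s) - \<phi> (g t)\<bar>" if "s \<in> {0..1}" "t \<in> {0..1}" for s t
    using bound that by (auto simp: path_image_def)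
  have inj: "inj_on (\<phi> \<circ> g) {0..1}"
    using bound' assms(2) by (fastforce simp: inj_on_def)
  have "continuous_on {0..1} (\<phi> \<circ> g)"
    using assms unfolding path_def path_image_def by (intro continuous_on_compose)
  then consider "strict_mono_on {0..1} (\<phi> \<circ> g)" | "strict_antimono_on {0..1} (\<phi> \<circ> g)"
    using injective_eq_monotone_map[of "{0..1}" "\<phi> \<circ> g"] inj by auto
  then show ?thesis
  proof cases
    case 1
    then have "\<phi> (g s) \<le> \<phi> (g t)" if "0 \<le> s" "s \<le> t" "t \<le> 1" for s t
      using that by (cases "s = t") (auto simp: monotone_on_def less_imp_le)
    then have "dist (g s) (g t) \<le> \<phi> (g t) - \<phi> (g s)" if "0 \<le> s" "s \<le> t" "t \<le> 1" for s t
      using bound'[of s t] that by force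
    then have "length_on g 0 1 \<le> \<phi> (g 1) - \<phi> (g 0)"
      using length_on_le_sum_increments[of 0 1 g "\<phi> \<circ> g"] by simp
    also have "\<dots> \<le> \<bar>\<phi> (g 0) - \<phi> (g 1)\<bar>"
      by simp
    finally show ?thesis
      unfolding path_length_eq pathstart_def pathfinish_def .
  next
    case 2
    then have "\<phi> (g t) \<le> \<phi> (g s)" if "0 \<le> s" "s \<le> t" "t \<le> 1" for s t
      using that by (cases "s = t") (auto simp: monotone_on_def less_imp_le)
    then have "dist (g s) (g t) \<le> \<phi> (g s) - \<phi> (g t)" if "0 \<le> s" "s \<le> t" "t \<le> 1" for s t
      using bound'[of s t] that by force
    then have "length_on g 0 1 \<le> \<phi> (g 0) - \<phi> (g 1)"
      using length_on_le_sum_increments[of 0 1 g "\<lambda>t. - \<phi> (g t)"] by simp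
    also have "\<dots> \<le> \<bar>\<phi> (g 0) - \<phi> (g 1)\<bar>"
      by simp
    finally show ?thesis
      unfolding path_length_eq pathstart_def pathfinish_def .
  qed
qed

subsection \<open>Halving pairs are at least half the width apart\<close>

lemma frontier_supporting_functional:
  fixes K :: "'a::euclidean_space set"
  assumes "convex K" "closed K" "interior K \<noteq> {}" "x \<in> frontier K"
  obtains n where "n \<noteq> 0" "\<And>y. y \<in> K \<Longrightarrow> n \<bullet> x \<le> n \<bullet> y" "\<And>y. y \<in> interior K \<Longrightarrow> n \<bullet> x < n \<bullet> y"
proof -
  have "x \<in> K" "x \<notin> rel_interior K"
    using assms by (auto simp: frontier_def rel_interior_nonempty_interior)
  then show ?thesis
    using supporting_hyperplane_rel_boundary[OF assms(1)] that assms(3)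
    by (metis rel_interior_nonempty_interior)
qed

text \<open>The factor \<open>norm u\<close> undoes the normalization in the definition of the
  width, so that supporting normals of any length can be used directly.\<close>

lemma curve_width_le_strip:
  assumes "C \<noteq> {}" "u \<noteq> 0" "\<And>x. x \<in> C \<Longrightarrow> a \<le> u \<bullet> x \<and> u \<bullet> x \<le> b"
  shows "curve_width C * norm u \<le> b - a"
proof -
  let ?W = "{b - a | u a b. norm u = 1 \<and> C \<subseteq> {x. a \<le> u \<bullet> x \<and> u \<bullet> x \<le> b}}"
  have "bdd_below ?W"
  proof (rule bdd_belowI[of _ 0])
    fix w assume "w \<in> ?W"
    then obtain u a b where "w = b - a" "C \<subseteq> {x. a \<le> u \<bullet> x \<and> u \<bullet> x \<le> b}"
      by blast
    then show "0 \<le> w"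
      using assms(1) by fastforce
  qed
  moreover have "b / norm u - a / norm u \<in> ?W"
    using assms(2,3)
    by (intro CollectI exI[of _ "u /\<^sub>R norm u"] exI[of _ "a / norm u"] exI[of _ "b / norm u"])
      (auto simp: field_simps)
  ultimately have "curve_width C \<le> b / norm u - a / norm u"
    unfolding curve_width_def by (rule cInf_lower[rotated])
  then show ?thesis
    using assms(2) by (simp add: field_simps)
qed

text \<open>The inverse of the parametrization maps the segment to a connected subset of
  \<open>{0..1}\<close> containing \<open>0\<close> and \<open>1\<close>, hence onto the whole
  interval.\<close>

lemma arc_image_eq_segment:
  fixes g :: "real \<Rightarrow> 'a::euclidean_space"
  assumes "arc g" "{pathstart g, pathfinish g} = {p, q}" "closed_segment p q \<subseteq> path_image g"
  shows "path_image g = closed_segment p q"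
proof -
  obtain h where h: "homeomorphism {0..1} (path_image g) g h"
    using assms(1) homeomorphism_arc by blast
  have "h p \<in> {0, 1}" "h q \<in> {0, 1}" "h p \<noteq> h q"
    using assms(2) homeomorphism_apply1[OF h] arc_distinct_ends[OF assms(1)]
    by (auto simp: pathstart_def pathfinish_def doubleton_eq_iff)
  moreover have "connected (h ` closed_segment p q)"
    by (intro connected_continuous_image continuous_on_subset[OF homeomorphism_cont2[OF h]] assms)
      auto
  ultimately have "{0..1} \<subseteq> h ` closed_segment p q"
    by (smt (verit) connected_contains_Icc empty_iff ends_in_segment imageI insert_iff)
  then have "g ` {0..1} \<subseteq> g ` h ` closed_segment p q"
    by blast
  also have "g ` h ` closed_segment p q = closed_segment p q"
    using assms(3) homeomorphism_apply2[OF h] by (force simp: image_iff subset_eq)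
  finally show ?thesis
    using assms(3) by (auto simp: path_image_def)
qed

text \<open>On a segment, distances are changes of the scalar product with the unit direction
  \<open>e\<close>, which serves as \<open>\<phi>\<close> in
  \<open>arc_length_le_increment\<close>.\<close>

lemma path_length_segment_arc:
  fixes g :: "real \<Rightarrow> 'a::euclidean_space"
  assumes "arc g" "{pathstart g, pathfinish g} = {p, q}" "closed_segment p q \<subseteq> path_image g"
  shows "path_length g \<le> dist p q"
proof -
  have img: "path_image g = closed_segment p q"
    using arc_image_eq_segment[OF assms] .
  have "p \<noteq> q"
    using assms(1,2) arc_distinct_ends by fastforce
  define e where "e = (q - p) /\<^sub>R dist p q"
  have e: "(q - p) \<bullet> e = dist p q"
    using \<open>p \<noteq> q\<close> by (simp add: e_def dist_norm norm_minus_commute dot_square_norm power2_eq_square)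
  have "dist x y \<le> \<bar>x \<bullet> e - y \<bullet> e\<bar>" if "x \<in> path_image g" "y \<in> path_image g" for x y
  proof -
    have "\<exists>s. x = (1 - s) *\<^sub>R p + s *\<^sub>R q" "\<exists>t. y = (1 - t) *\<^sub>R p + t *\<^sub>R q"
      using that unfolding img in_segment by blast+
    then obtain s t where st: "x = (1 - s) *\<^sub>R p + s *\<^sub>R q" "y = (1 - t) *\<^sub>R p + t *\<^sub>R q"
      by (elim exE)
    have "x - y = (s - t) *\<^sub>R (q - p)"
      unfolding st by (simp add: algebra_simps)
    then have "dist x y = \<bar>s - t\<bar> * dist p q" "(x - y) \<bullet> e = (s - t) * dist p q"
      using e by (simp_all add: dist_norm norm_minus_commute)
    then show ?thesis
      by (simp add: abs_mult flip: inner_diff_left)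
  qed
  then have "path_length g \<le> \<bar>pathstart g \<bullet> e - pathfinish g \<bullet> e\<bar>"
    using assms(1) by (intro arc_length_le_increment) (auto simp: arc_def intro!: continuous_intros)
  also have "\<bar>pathstart g \<bullet> e - pathfinish g \<bullet> e\<bar> = dist p q"
  proof -
    have "pathstart g \<bullet> e - pathfinish g \<bullet> e \<in> {- dist p q, dist p q}"
      using assms(2) e by (auto simp: doubleton_eq_iff inner_diff_left)
    then show ?thesis
      by auto
  qed
  finally show ?thesis .
qed

section \<open>Oblique coordinates along two supporting lines\<close>

lemma inner_real2: "(x :: real^2) \<bullet> y = x $ 1 * y $ 1 + x $ 2 * y $ 2"
  by (simp add: inner_vec_def sum_2)

text \<open>Up to scaling, \<open>n2\<close> and \<open>n1\<close> form the dual basis of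
  \<open>P\<close>, \<open>Q\<close>. Both annihilate the difference of the two sides, and their
  determinant is nonzero.\<close>

lemma real2_coordinates:
  fixes P Q n1 n2 x :: "real^2"
  assumes "n1 \<bullet> P = 0" "n1 \<bullet> Q > 0" "n2 \<bullet> Q = 0" "n2 \<bullet> P > 0"
  shows "x = (n2 \<bullet> x / (n2 \<bullet> P)) *\<^sub>R P + (n1 \<bullet> x / (n1 \<bullet> Q)) *\<^sub>R Q"
proof -
  define y where "y = x - (n2 \<bullet> x / (n2 \<bullet> P)) *\<^sub>R P - (n1 \<bullet> x / (n1 \<bullet> Q)) *\<^sub>R Q"
  have y: "n1 \<bullet> y = 0" "n2 \<bullet> y = 0"
    using assms by (simp_all add: y_def inner_diff_right)
  \<comment> \<open>A product of two determinants; positivity of the left side shows that the one of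
    \<open>n1\<close>, \<open>n2\<close> is nonzero.\<close>
  have "n1 \<bullet> Q * (n2 \<bullet> P) - n1 \<bullet> P * (n2 \<bullet> Q) =
      (n1 $ 1 * n2 $ 2 - n1 $ 2 * n2 $ 1) * (Q $ 1 * P $ 2 - Q $ 2 * P $ 1)"
    by (simp add: inner_real2 algebra_simps)
  then have D: "n1 $ 1 * n2 $ 2 - n1 $ 2 * n2 $ 1 \<noteq> 0"
    using assms by auto
  have "(n1 $ 1 * n2 $ 2 - n1 $ 2 * n2 $ 1) * y $ 1 = n2 $ 2 * (n1 \<bullet> y) - n1 $ 2 * (n2 \<bullet> y)"
       "(n1 $ 1 * n2 $ 2 - n1 $ 2 * n2 $ 1) * y $ 2 = n1 $ 1 * (n2 \<bullet> y) - n2 $ 1 * (n1 \<bullet> y)"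
    by (simp_all add: inner_real2 algebra_simps)
  then have "y = 0"
    using y D by (simp add: vec_eq_iff forall_2)
  then show ?thesis
    by (simp add: y_def algebra_simps)
qed

text \<open>The supporting lines of \<open>K\<close> at \<open>z + P\<close> and \<open>z + Q\<close> meet in \<open>z\<close>; \<open>\<sigma>\<close> and \<open>\<tau>\<close> are the
  coordinates with origin \<open>z\<close> and basis \<open>P\<close>, \<open>Q\<close>.\<close>

locale tangent_cone =
  fixes K :: "(real^2) set" and z P Q n1 n2 :: "real^2"
  assumes K: "convex K" "compact K" "interior K \<noteq> {}"
    and n: "n1 \<bullet> P = 0" "n1 \<bullet> Q > 0" "n2 \<bullet> Q = 0" "n2 \<bullet> P > 0"
    and supp: "\<And>x. x \<in> K \<Longrightarrow> n1 \<bullet> (x - z) \<ge> 0" "\<And>x. x \<in> K \<Longrightarrow> n2 \<bullet> (x - z) \<ge> 0"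
    and ends: "z + P \<in> frontier K" "z + Q \<in> frontier K"
    and chord: "open_segment (z + P) (z + Q) \<subseteq> interior K"
begin

definition \<sigma> :: "real^2 \<Rightarrow> real" where "\<sigma> x = n2 \<bullet> (x - z) / (n2 \<bullet> P)"
definition \<tau> :: "real^2 \<Rightarrow> real" where "\<tau> x = n1 \<bullet> (x - z) / (n1 \<bullet> Q)"

lemma coordinates: "x = z + \<sigma> x *\<^sub>R P + \<tau> x *\<^sub>R Q"
  using real2_coordinates[OF n, of "x - z"] by (simp add: \<sigma>_def \<tau>_def algebra_simps)

lemma coordinates_simps [simp]: "\<sigma> (z + P) = 1" "\<tau> (z + P) = 0" "\<sigma> (z + Q) = 0" "\<tau> (z + Q) = 1"
  using n by (simp_all add: \<sigma>_def \<tau>_def)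

lemma continuous_coordinates [continuous_intros]: "continuous_on S \<sigma>" "continuous_on S \<tau>"
  unfolding \<sigma>_def \<tau>_def using n by (auto intro!: continuous_intros)

lemma frontier_subset: "frontier K \<subseteq> K"
  using K by (simp add: compact_imp_closed frontier_subset_closed)

lemma coordinates_nonneg: "x \<in> K \<Longrightarrow> 0 \<le> \<sigma> x" "x \<in> K \<Longrightarrow> 0 \<le> \<tau> x"
  using supp n by (simp_all add: \<sigma>_def \<tau>_def)

lemma nonzero: "P \<noteq> 0" "Q \<noteq> 0" "n1 \<noteq> 0"
  using n by auto

lemma ends_neq: "z + P \<noteq> z + Q"
  using n by auto

text \<open>\<open>\<sigma> + \<tau> = 1\<close> describes the line through both points of contact.
  Nonnegative coordinates confine \<open>x\<close> to the chord, whose open part is interior to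
  \<open>K\<close>.\<close>

lemma frontier_on_chord:
  assumes "x \<in> frontier K" "\<sigma> x + \<tau> x = 1"
  shows "x = z + P \<or> x = z + Q"
proof -
  have "x = (1 - \<tau> x) *\<^sub>R (z + P) + \<tau> x *\<^sub>R (z + Q)"
  proof -
    have \<sigma>: "\<sigma> x = 1 - \<tau> x"
      using assms(2) by simp
    show ?thesis
      by (subst coordinates[of x], unfold \<sigma>) (simp add: algebra_simps)
  qed
  moreover have "0 \<le> \<tau> x" "\<tau> x \<le> 1"
    using coordinates_nonneg[of x] assms frontier_subset by auto
  ultimately have "x \<in> closed_segment (z + P) (z + Q)"
    by (auto simp: in_segment)
  then show ?thesis
    using chord assms(1) by (auto simp: open_segment_def frontier_def)
qed

text \<open>If \<open>y\<close> were strictly closer to both tangents than \<open>x\<close>, then \<open>x\<close> would be interior to the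
  triangle with vertices \<open>y\<close>, \<open>z + P\<close>, \<open>z + Q\<close>.\<close>

lemma frontier_no_dominance:
  assumes "x \<in> frontier K" "y \<in> frontier K" "\<sigma> x + \<tau> x \<le> 1" "\<sigma> y < \<sigma> x" "\<tau> y < \<tau> x"
  shows False
proof (cases "\<sigma> x + \<tau> x = 1")
  case True
  then show False
    using frontier_on_chord[of x] coordinates_nonneg[of y] assms frontier_subset by auto
next
  case False
  obtain n where n: "n \<noteq> 0" "\<And>w. w \<in> K \<Longrightarrow> n \<bullet> x \<le> n \<bullet> w" "\<And>w. w \<in> interior K \<Longrightarrow> n \<bullet> x < n \<bullet> w"
    using frontier_supporting_functional[of K x] K assms(1) compact_imp_closed by blast
  define \<alpha> \<beta> where "\<alpha> = n \<bullet> P" and "\<beta> = n \<bullet> Q"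
  have eq: "n \<bullet> w = n \<bullet> z + \<alpha> * \<sigma> w + \<beta> * \<tau> w" for w
    by (subst coordinates[of w]) (simp add: \<alpha>_def \<beta>_def inner_add_right)
  have m: "midpoint (z + P) (z + Q) \<in> interior K"
    using chord ends_neq by auto
  have M: "\<alpha> * \<sigma> x + \<beta> * \<tau> x \<le> \<alpha>" "\<alpha> * \<sigma> x + \<beta> * \<tau> x \<le> \<beta>"
    using n(2)[of "z + P"] n(2)[of "z + Q"] ends frontier_subset eq[of "z + P"] eq[of "z + Q"] eq[of x]
    by auto
  have xy: "0 \<le> \<sigma> x" "0 \<le> \<tau> x"
    using coordinates_nonneg[of x] assms frontier_subset by auto
  have lt: "\<sigma> x + \<tau> x < 1"
    using False assms(3) by simp
  \<comment> \<open>If the smaller coefficient \<open>\<mu>\<close> were negative, the value at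
    \<open>x\<close> would exceed \<open>\<mu>\<close> because
    \<open>\<sigma> x + \<tau> x < 1\<close>, contradicting \<open>M\<close>.\<close>
  have "0 \<le> \<alpha> \<and> 0 \<le> \<beta>"
  proof (rule ccontr)
    assume neg: "\<not> (0 \<le> \<alpha> \<and> 0 \<le> \<beta>)"
    define \<mu> where "\<mu> = min \<alpha> \<beta>"
    have "\<mu> < 0"
      using neg by (auto simp: \<mu>_def)
    then have "\<mu> < \<mu> * (\<sigma> x + \<tau> x)"
      using mult_strict_left_mono_neg[OF lt, of \<mu>] by simp
    also have "\<dots> \<le> \<alpha> * \<sigma> x + \<beta> * \<tau> x"
      unfolding distrib_left by (intro add_mono mult_right_mono xy) (auto simp: \<mu>_def)
    finally show False
      using M by (simp add: \<mu>_def)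
  qed
  \<comment> \<open>Minimality at \<open>x\<close>, compared with \<open>y\<close>, leaves only
    \<open>\<alpha> = \<beta> = 0\<close>. Then \<open>n\<close> is a constant functional, contrary
    to strictness at the interior midpoint.\<close>
  moreover have "\<alpha> * (\<sigma> x - \<sigma> y) + \<beta> * (\<tau> x - \<tau> y) \<le> 0"
    using n(2)[of y] assms(2) frontier_subset eq[of x] eq[of y] by (auto simp: algebra_simps)
  ultimately have "\<alpha> * (\<sigma> x - \<sigma> y) = 0" "\<beta> * (\<tau> x - \<tau> y) = 0"
    using assms(4,5) by (smt (verit) mult_nonneg_nonneg)+
  then have "\<alpha> = 0" "\<beta> = 0"
    using assms(4,5) by auto
  then show False
    using n(3)[OF m] eq[of x] eq[of "midpoint (z + P) (z + Q)"] by simp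
qed

text \<open>Apart from its ends the arc never meets the line of the chord, so by connectedness it
  stays on the side of \<open>x\<^sub>0\<close>.\<close>

lemma arc_near_apex:
  assumes "arc g" "path_image g \<subseteq> frontier K" "{pathstart g, pathfinish g} = {z + P, z + Q}"
    and "x\<^sub>0 \<in> path_image g" "\<sigma> x\<^sub>0 + \<tau> x\<^sub>0 < 1" "x \<in> path_image g"
  shows "\<sigma> x + \<tau> x \<le> 1"
proof -
  define S where "S = g ` {0<..<1}"
  define f where "f = (\<lambda>x. \<sigma> x + \<tau> x)"
  have img: "path_image g = insert (pathstart g) (insert (pathfinish g) S)"
  proof -
    have "{0..1::real} = insert 0 (insert 1 {0<..<1})"
      by auto
    then show ?thesis
      unfolding path_image_def S_def pathstart_def pathfinish_def by (metis image_insert)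
  qed
  have f_ends: "f (pathstart g) = 1" "f (pathfinish g) = 1"
    using assms(3) by (auto simp: f_def doubleton_eq_iff)
  have "f y \<noteq> 1" if y: "y \<in> S" for y
  proof
    assume "f y = 1"
    then have "y = z + P \<or> y = z + Q"
      using frontier_on_chord[of y] y assms(2) img by (auto simp: f_def)
    then have "y = pathstart g \<or> y = pathfinish g"
      using assms(3) by (metis insert_iff singletonD)
    moreover obtain t where "t \<in> {0<..<1}" "y = g t"
      using y unfolding S_def by blast
    ultimately have "g t = g 0 \<or> g t = g 1" "0 < t" "t < 1"
      by (auto simp: pathstart_def pathfinish_def)
    moreover have "inj_on g {0..1}"
      using assms(1) by (simp add: arc_def)
    ultimately have "t = 0 \<or> t = 1"
      by (metis atLeastAtMost_iff inj_onD less_imp_le zero_le_one order_refl)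
    then show False
      using \<open>0 < t\<close> \<open>t < 1\<close> by simp
  qed
  moreover have "connected (f ` S)"
    unfolding S_def f_def using assms(1)
    by (intro connected_continuous_image continuous_intros)
      (auto simp: arc_def path_def intro: continuous_on_subset)
  moreover have "x\<^sub>0 \<in> S"
    using assms(4,5) img f_ends by (auto simp: f_def)
  ultimately have "f y < 1" if "y \<in> S" for y
    using that assms(5) connectedD_interval[of "f ` S" "f x\<^sub>0" "f y" 1]
    by (force simp: f_def not_less)
  then show ?thesis
    using assms(6) img f_ends by (fastforce simp: f_def)
qed

text \<open>By \<open>frontier_no_dominance\<close> the two coordinates never change strictly in the
  same direction. Hence the change of \<open>\<phi>\<close> is the sum of the weighted coordinate
  changes, which dominates the distance.\<close>

lemma path_length_near_apex:
  assumes "arc g" "path_image g \<subseteq> frontier K" "{pathstart g, pathfinish g} = {z + P, z + Q}"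
    and "x\<^sub>0 \<in> path_image g" "\<sigma> x\<^sub>0 + \<tau> x\<^sub>0 < 1"
  shows "path_length g \<le> norm P + norm Q"
proof -
  define \<phi> where "\<phi> x = norm Q * \<tau> x - norm P * \<sigma> x" for x
  have "dist x y \<le> \<bar>\<phi> x - \<phi> y\<bar>" if "x \<in> path_image g" "y \<in> path_image g" for x y
  proof -
    have "\<not> (\<sigma> y < \<sigma> x \<and> \<tau> y < \<tau> x)" "\<not> (\<sigma> x < \<sigma> y \<and> \<tau> x < \<tau> y)"
      using frontier_no_dominance arc_near_apex[OF assms] that assms(2) by blast+
    then have "(0 \<le> \<sigma> x - \<sigma> y \<and> \<tau> x - \<tau> y \<le> 0) \<or> (\<sigma> x - \<sigma> y \<le> 0 \<and> 0 \<le> \<tau> x - \<tau> y)"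
      by linarith
    moreover have "\<phi> x - \<phi> y = norm Q * (\<tau> x - \<tau> y) - norm P * (\<sigma> x - \<sigma> y)"
      by (simp add: \<phi>_def algebra_simps)
    ultimately have "norm P * \<bar>\<sigma> x - \<sigma> y\<bar> + norm Q * \<bar>\<tau> x - \<tau> y\<bar> \<le> \<bar>\<phi> x - \<phi> y\<bar>"
      by (auto simp: abs_if mult_nonneg_nonneg mult_nonneg_nonpos algebra_simps)
    moreover have "x - y = (\<sigma> x - \<sigma> y) *\<^sub>R P + (\<tau> x - \<tau> y) *\<^sub>R Q"
      by (subst coordinates[of x], subst coordinates[of y]) (simp add: algebra_simps)
    ultimately show ?thesis
      unfolding dist_norm
      using norm_triangle_ineq[of "(\<sigma> x - \<sigma> y) *\<^sub>R P" "(\<tau> x - \<tau> y) *\<^sub>R Q"]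
      by (simp add: mult.commute)
  qed
  then have "path_length g \<le> \<bar>\<phi> (pathstart g) - \<phi> (pathfinish g)\<bar>"
    using assms(1) unfolding \<phi>_def
    by (intro arc_length_le_increment) (auto simp: arc_def intro!: continuous_intros)
  also have "\<bar>\<phi> (pathstart g) - \<phi> (pathfinish g)\<bar> = norm P + norm Q"
  proof -
    have "\<phi> (pathstart g) - \<phi> (pathfinish g) \<in> {norm P + norm Q, - (norm P + norm Q)}"
      using assms(3) by (auto simp: \<phi>_def doubleton_eq_iff)
    then show ?thesis
      by (metis abs_minus_cancel abs_of_nonneg add_nonneg_nonneg insertE norm_ge_zero singletonD)
  qed
  finally show ?thesis .
qed

text \<open>The apex is not interior, so the segment to it from the interior midpoint of the chord
  meets the frontier; \<open>\<sigma> + \<tau>\<close> drops below \<open>1\<close> as soon as the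
  midpoint is left.\<close>

lemma frontier_near_apex: obtains x where "x \<in> frontier K" "\<sigma> x + \<tau> x < 1"
proof -
  define m where "m = midpoint (z + P) (z + Q)"
  have m: "m \<in> interior K"
    using chord ends_neq unfolding m_def by auto
  have "z \<notin> interior K"
  proof
    assume "z \<in> interior K"
    then obtain e where e: "e > 0" "cball z e \<subseteq> K"
      by (meson mem_interior_cball)
    \<comment> \<open>A step from \<open>z\<close> away from \<open>Q\<close> would cross the
      supporting line with normal \<open>n1\<close>.\<close>
    have "z - (e / norm Q) *\<^sub>R Q \<in> K"
      using e n by (intro subsetD[OF e(2)]) (auto simp: dist_norm)
    then have "(e / norm Q) * (n1 \<bullet> Q) \<le> 0"
      using supp(1) by fastforce
    moreover have "(e / norm Q) * (n1 \<bullet> Q) > 0"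
      using e nonzero n by (intro mult_pos_pos) auto
    ultimately show False
      by linarith
  qed
  then have "closed_segment m z \<inter> frontier (interior K) \<noteq> {}"
    using m by (intro connected_Int_frontier) auto
  then obtain x where x: "x \<in> closed_segment m z" "x \<in> frontier (interior K)"
    by blast
  have fr: "x \<in> frontier K"
    using x(2) K by (metis convex_closure_interior frontier_def interior_interior)
  obtain u where u: "0 \<le> u" "u \<le> 1" "x = (1 - u) *\<^sub>R m + u *\<^sub>R z"
    using x(1) by (auto simp: in_segment)
  have "x \<noteq> m"
    using m x(2) by (auto simp: frontier_def)
  then have "u > 0"
    using u by (cases "u = 0") auto
  have "x - z = ((1 - u) / 2) *\<^sub>R (P + Q)"
    unfolding u(3) m_def midpoint_def by (simp add: vec_eq_iff field_simps)
  then have "\<sigma> x + \<tau> x = 1 - u"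
    using n by (simp add: \<sigma>_def \<tau>_def inner_add_right)
  then show ?thesis
    using that[OF fr] \<open>u > 0\<close> by simp
qed

text \<open>The hypothesis confines the curve to the isosceles triangle with legs
  \<open>a + b\<close>. The strip used has normal \<open>n1\<close>, and one of its sides is the
  supporting line through \<open>z\<close> and \<open>z + P\<close>.\<close>

lemma curve_width_le:
  assumes "\<And>x. x \<in> frontier K \<Longrightarrow> dist (z + P) x + dist x (z + Q) \<le> norm P + norm Q"
  shows "curve_width (frontier K) \<le> 2 * dist (z + P) (z + Q)"
proof -
  \<comment> \<open>\<open>c\<close> is the cosine of the angle at \<open>z\<close>;
    \<open>k\<close> below is the growth of \<open>n1\<close> per unit length in direction
    \<open>Q\<close>.\<close>
  define a b c where "a = norm P" and "b = norm Q" and "c = P \<bullet> Q / (a * b)"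
  have ab: "a > 0" "b > 0"
    using n by (auto simp: a_def b_def)
  have PQ: "P \<bullet> Q = a * b * c" "P \<bullet> P = a\<^sup>2" "Q \<bullet> Q = b\<^sup>2"
    using ab by (simp_all add: c_def a_def b_def dot_square_norm)
  define k where "k = n1 \<bullet> Q / b"
  have k: "k > 0"
    using ab n by (simp add: k_def)
  \<comment> \<open>This vector is a multiple of the component of \<open>Q\<close> orthogonal to
    \<open>P\<close>. Cauchy-Schwarz against it bounds \<open>k\<close> by \<open>norm n1\<close>
    times the sine of the angle.\<close>
  have sq: "(norm (a *\<^sub>R Q - (b * c) *\<^sub>R P))\<^sup>2 = (a * b)\<^sup>2 * (1 - c\<^sup>2)"
    unfolding power2_norm_eq_inner
    by (simp add: inner_diff_left inner_diff_right PQ inner_commute[of Q P] power2_eq_square algebra_simps)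
  have "a * b * k = n1 \<bullet> (a *\<^sub>R Q - (b * c) *\<^sub>R P)"
    using n ab by (simp add: k_def inner_diff_right)
  also have "\<dots> \<le> norm n1 * norm (a *\<^sub>R Q - (b * c) *\<^sub>R P)"
    by (rule norm_cauchy_schwarz)
  finally have "(a * b * k)\<^sup>2 \<le> (norm n1 * norm (a *\<^sub>R Q - (b * c) *\<^sub>R P))\<^sup>2"
    using ab k by (intro power_mono) auto
  then have "(a * b)\<^sup>2 * k\<^sup>2 \<le> (a * b)\<^sup>2 * ((norm n1)\<^sup>2 * (1 - c\<^sup>2))"
    unfolding power_mult_distrib sq by (simp add: mult_ac)
  then have ksq: "k\<^sup>2 \<le> (norm n1)\<^sup>2 * (1 - c\<^sup>2)"
    using ab by (metis mult_le_cancel_left_pos mult_pos_pos zero_less_power)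
  have "0 < (norm n1)\<^sup>2 * (1 - c\<^sup>2)"
    using ksq k by (meson less_le_trans zero_less_power)
  then have "c\<^sup>2 < 1"
    by (simp add: zero_less_mult_iff)
  then have c: "-1 < c" "c < 1"
    by (simp_all add: abs_square_less_1 abs_less_iff)
  have tau: "n1 \<bullet> x = n1 \<bullet> z + \<tau> x * b * k" for x
    using n ab by (simp add: \<tau>_def k_def inner_diff_right)
  have strip: "n1 \<bullet> z \<le> n1 \<bullet> x \<and> n1 \<bullet> x \<le> n1 \<bullet> z + (a + b) * k" if x: "x \<in> frontier K" for x
  proof -
    have nonneg: "0 \<le> \<sigma> x" "0 \<le> \<tau> x"
      using coordinates_nonneg x frontier_subset by auto
    have 1: "x - (z + P) = (\<sigma> x - 1) *\<^sub>R P + \<tau> x *\<^sub>R Q" "x - (z + Q) = \<sigma> x *\<^sub>R P + (\<tau> x - 1) *\<^sub>R Q"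
      using coordinates[of x] by (simp_all add: algebra_simps)
    \<comment> \<open>\<open>Q\<close> and \<open>P\<close> point from the two foci to the tangency
      point \<open>z + P + Q\<close>. Adding both projection bounds gives the half-plane of the
      ellipse's tangent there.\<close>
    have "(x - (z + P)) \<bullet> Q \<le> dist (z + P) x * b"
      using norm_cauchy_schwarz[of "x - (z + P)" Q] by (simp add: b_def dist_norm norm_minus_commute)
    then have "b * ((\<sigma> x - 1) * a * c + \<tau> x * b) \<le> b * dist (z + P) x"
      unfolding 1 by (simp add: inner_add_left PQ power2_eq_square algebra_simps)
    then have A: "(\<sigma> x - 1) * a * c + \<tau> x * b \<le> dist (z + P) x"
      using ab by simp
    have "(x - (z + Q)) \<bullet> P \<le> dist x (z + Q) * a"
      using norm_cauchy_schwarz[of "x - (z + Q)" P] by (simp add: a_def dist_norm)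
    then have "a * (\<sigma> x * a + (\<tau> x - 1) * b * c) \<le> a * dist x (z + Q)"
      unfolding 1 by (simp add: inner_add_left PQ inner_commute[of Q P] power2_eq_square algebra_simps)
    then have B: "\<sigma> x * a + (\<tau> x - 1) * b * c \<le> dist x (z + Q)"
      using ab by simp
    have "(\<sigma> x * a + \<tau> x * b) * (1 + c) \<le> (a + b) * (1 + c)"
      using A B assms[OF x] by (simp add: a_def b_def algebra_simps)
    then have "\<sigma> x * a + \<tau> x * b \<le> a + b"
      using c by simp
    then have "\<tau> x * b \<le> a + b"
      using nonneg ab by (smt (verit) mult_nonneg_nonneg)
    then show ?thesis
      using tau[of x] k nonneg ab by (simp add: mult_right_mono)
  qed
  have "curve_width (frontier K) * norm n1 \<le> (a + b) * k"
    using curve_width_le_strip[of "frontier K" n1 "n1 \<bullet> z" "n1 \<bullet> z + (a + b) * k"] strip ends nonzero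
    by force
  also have "(a + b) * k \<le> 2 * dist (z + P) (z + Q) * norm n1"
  proof (rule power2_le_imp_le)
    have d: "(dist (z + P) (z + Q))\<^sup>2 = a\<^sup>2 + b\<^sup>2 - 2 * a * b * c"
      by (simp add: dist_norm power2_norm_eq_inner inner_diff_left inner_diff_right PQ
          inner_commute[of Q P])
    \<comment> \<open>Replaces the half-angle estimate: the difference of the two sides is written
      as a sum of nonnegative terms.\<close>
    have "4 * (a\<^sup>2 + b\<^sup>2 - 2 * a * b * c) - (a + b)\<^sup>2 * (1 - c\<^sup>2)
        = 2 * ((a - b)\<^sup>2 * (1 + c)) + (a + b)\<^sup>2 * (1 - c)\<^sup>2"
      by (simp add: power2_eq_square algebra_simps)
    then have "(a + b)\<^sup>2 * (1 - c\<^sup>2) \<le> 4 * (a\<^sup>2 + b\<^sup>2 - 2 * a * b * c)"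
      using c by (smt (verit) mult_nonneg_nonneg zero_le_power2)
    then have "(norm n1)\<^sup>2 * ((a + b)\<^sup>2 * (1 - c\<^sup>2)) \<le> (norm n1)\<^sup>2 * (4 * (a\<^sup>2 + b\<^sup>2 - 2 * a * b * c))"
      by (intro mult_left_mono) auto
    moreover have "((a + b) * k)\<^sup>2 \<le> (a + b)\<^sup>2 * ((norm n1)\<^sup>2 * (1 - c\<^sup>2))"
      unfolding power_mult_distrib using ksq by (intro mult_left_mono) auto
    ultimately show "((a + b) * k)\<^sup>2 \<le> (2 * dist (z + P) (z + Q) * norm n1)\<^sup>2"
      unfolding power_mult_distrib d by (simp add: mult_ac)
  qed auto
  finally show ?thesis
    using nonzero by simp
qed

end

section \<open>Chords inside and on the curve, and the bound for every halving pair\<close>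

lemma open_segment_frontier_cases:
  fixes K :: "'a::euclidean_space set"
  assumes "convex K" "closed K" "interior K \<noteq> {}" "p \<in> K" "q \<in> K"
  obtains "open_segment p q \<subseteq> interior K"
    | n where "n \<noteq> 0" "n \<bullet> p = n \<bullet> q" "closed_segment p q \<subseteq> frontier K"
proof (cases "open_segment p q \<subseteq> interior K")
  case False
  have seg: "closed_segment p q \<subseteq> K"
    using assms by (simp add: closed_segment_subset)
  then obtain m where m: "m \<in> open_segment p q" "m \<in> frontier K"
    using False assms(2) by (auto simp: frontier_def open_segment_def)
  obtain n where n: "n \<noteq> 0" "\<And>y. y \<in> K \<Longrightarrow> n \<bullet> m \<le> n \<bullet> y" "\<And>y. y \<in> interior K \<Longrightarrow> n \<bullet> m < n \<bullet> y"
    using frontier_supporting_functional[OF assms(1-3) m(2)] by blast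
  obtain u where u: "0 < u" "u < 1" "m = (1 - u) *\<^sub>R p + u *\<^sub>R q"
    using m(1) by (auto simp: in_segment)
  have nm: "n \<bullet> m = (1 - u) * (n \<bullet> p) + u * (n \<bullet> q)"
    by (simp add: u(3) inner_add_right)
  have "n \<bullet> m \<le> n \<bullet> p" "n \<bullet> m \<le> n \<bullet> q"
    using n(2) assms by auto
  \<comment> \<open>An affine function on the chord that attains its minimum at the inner point
    \<open>m\<close> is constant there.\<close>
  have eq: "n \<bullet> p = n \<bullet> m \<and> n \<bullet> q = n \<bullet> m"
  proof -
    have "(1 - u) * (n \<bullet> p - n \<bullet> m) + u * (n \<bullet> q - n \<bullet> m) = 0"
      using nm by (simp add: algebra_simps)
    moreover have "0 \<le> (1 - u) * (n \<bullet> p - n \<bullet> m)" "0 \<le> u * (n \<bullet> q - n \<bullet> m)"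
      using u \<open>n \<bullet> m \<le> n \<bullet> p\<close> \<open>n \<bullet> m \<le> n \<bullet> q\<close> by auto
    ultimately have "(1 - u) * (n \<bullet> p - n \<bullet> m) = 0" "u * (n \<bullet> q - n \<bullet> m) = 0"
      by linarith+
    then show ?thesis
      using u by auto
  qed
  have "n \<bullet> y = n \<bullet> m" if y: "y \<in> closed_segment p q" for y
  proof -
    obtain v where v: "y = (1 - v) *\<^sub>R p + v *\<^sub>R q"
      using y unfolding in_segment by blast
    show ?thesis
      unfolding v using eq by (simp add: inner_add_right left_diff_distrib)
  qed
  then have "closed_segment p q \<subseteq> frontier K"
    using seg n(3) closure_subset[of K] by (fastforce simp: frontier_def)
  then show ?thesis
    using that(2) n(1) eq by simp
qed

text \<open>The connected open chord lies in one arc, which is then the segment itself. Equal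
  lengths force all of \<open>C\<close> into that segment, so the strip with normal \<open>n\<close>
  degenerates to a line.\<close>

lemma curve_width_le_chord_on_frontier:
  assumes arcs: "arc g1" "{pathstart g1, pathfinish g1} = {p, q}"
      "arc g2" "{pathstart g2, pathfinish g2} = {p, q}"
    and un: "path_image g1 \<union> path_image g2 = C" and int: "path_image g1 \<inter> path_image g2 = {p, q}"
    and len: "path_length g1 = path_length g2"
    and seg: "closed_segment p q \<subseteq> C" and n: "n \<noteq> 0" "n \<bullet> p = n \<bullet> q"
  shows "curve_width C \<le> 0"
proof -
  have "open_segment p q \<subseteq> path_image g1 \<union> path_image g2"
    using seg un by (auto simp: open_segment_def)
  moreover have "path_image g1 \<inter> path_image g2 \<inter> open_segment p q = {}"
    unfolding int by (auto simp: open_segment_def)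
  moreover have "closed (path_image g1)" "closed (path_image g2)"
    using arcs by (simp_all add: closed_arc_image)
  ultimately have "path_image g1 \<inter> open_segment p q = {} \<or> path_image g2 \<inter> open_segment p q = {}"
    by (intro connected_closedD) (auto simp: convex_connected)
  then have "closed_segment p q \<subseteq> path_image g1 \<or> closed_segment p q \<subseteq> path_image g2"
    using \<open>open_segment p q \<subseteq> _\<close> int by (auto simp: open_segment_def)
  then have L: "path_length g1 \<le> dist p q"
    using path_length_segment_arc[of g1 p q] path_length_segment_arc[of g2 p q] arcs len by metis
  have "x \<in> closed_segment p q" if "x \<in> C" for x
  proof -
    have "ereal (dist p x + dist x q) \<le> path_length g1"
      using that un len arcs dist_sum_le_path_length[of x g1] dist_sum_le_path_length[of x g2]
      by (auto simp: doubleton_eq_iff dist_commute add.commute)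
    then have "dist p x + dist x q \<le> dist p q"
      using L by (metis ereal_less_eq(3) order_trans)
    then have "dist p q = dist p x + dist x q"
      using dist_triangle[of p q x] by linarith
    then show ?thesis
      by (simp add: between between_mem_segment[symmetric])
  qed
  then have "n \<bullet> p \<le> n \<bullet> x \<and> n \<bullet> x \<le> n \<bullet> p" if "x \<in> C" for x
  proof -
    obtain v where v: "x = (1 - v) *\<^sub>R p + v *\<^sub>R q"
      using \<open>x \<in> C\<close> \<open>\<And>x. x \<in> C \<Longrightarrow> x \<in> closed_segment p q\<close> unfolding in_segment by blast
    show ?thesis
      unfolding v using n(2) by (simp add: inner_add_right left_diff_distrib)
  qed
  moreover have "C \<noteq> {}"
    using seg by auto
  ultimately have "curve_width C * norm n \<le> n \<bullet> p - n \<bullet> p"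
    using n(1) by (intro curve_width_le_strip)
  then show ?thesis
    using n(1) by (simp add: mult_le_0_iff)
qed

text \<open>Cramer's rule; \<open>y\<close> is the solution multiplied by the determinant
  \<open>D\<close>.\<close>

lemma meeting_point:
  fixes n1 n2 p q :: "real^2"
  assumes "n1 $ 1 * n2 $ 2 - n1 $ 2 * n2 $ 1 \<noteq> 0"
  obtains z where "n1 \<bullet> z = n1 \<bullet> p" "n2 \<bullet> z = n2 \<bullet> q"
proof -
  define D where "D = n1 $ 1 * n2 $ 2 - n1 $ 2 * n2 $ 1"
  define y :: "real^2" where "y = vector [(n1 \<bullet> p) * n2 $ 2 - (n2 \<bullet> q) * n1 $ 2,
      (n2 \<bullet> q) * n1 $ 1 - (n1 \<bullet> p) * n2 $ 1]"
  have "n1 \<bullet> y = (n1 \<bullet> p) * D" "n2 \<bullet> y = (n2 \<bullet> q) * D"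
    unfolding inner_real2[of n1 y] inner_real2[of n2 y]
    by (simp_all add: y_def D_def algebra_simps)
  then show ?thesis
    using that[of "(1 / D) *\<^sub>R y"] assms by (simp add: D_def)
qed

lemma curve_width_le_halving_pair:
  assumes C: "closed_convex_curve C" and hp: "halving_pair C p q"
  shows "curve_width C \<le> 2 * dist p q"
proof -
  obtain K where K: "compact K" "convex K" "interior K \<noteq> {}" and CK_eq: "C = frontier K"
    using C by (auto simp: closed_convex_curve_def)
  have closed: "closed K" and CK: "C \<subseteq> K"
    using K CK_eq by (auto simp: compact_imp_closed frontier_subset_closed)
  obtain g1 g2 where g: "arc g1" "pathstart g1 = p" "pathfinish g1 = q"
      "arc g2" "pathstart g2 = q" "pathfinish g2 = p"
      and un: "path_image g1 \<union> path_image g2 = C" and int: "path_image g1 \<inter> path_image g2 = {p, q}"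
      and len: "path_length g1 = path_length g2"
    using hp unfolding halving_pair_def by blast
  have pq: "p \<in> C" "q \<in> C" "p \<noteq> q"
    using int un arc_distinct_ends[OF g(1)] g by auto
  have sum_le: "ereal (dist p x + dist x q) \<le> path_length g1" if "x \<in> C" for x
    using that un len g dist_sum_le_path_length[of x g1] dist_sum_le_path_length[of x g2]
    by (auto simp: dist_commute add.commute)
  consider "open_segment p q \<subseteq> interior K"
    | n where "n \<noteq> 0" "n \<bullet> p = n \<bullet> q" "closed_segment p q \<subseteq> C"
    using open_segment_frontier_cases[of K p q] K CK_eq closed pq CK by blast
  then show ?thesis
  proof cases
    case 2
    then have "curve_width C \<le> 0"
      using curve_width_le_chord_on_frontier[of g1 p q g2 C n] g un int len by auto
    then show ?thesis
      by (smt (verit) zero_le_dist)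
  next
    case 1
    \<comment> \<open>Strictness of the supporting inequalities at this interior point makes each
      normal increase strictly along the chord from its own point of contact.\<close>
    define m where "m = midpoint p q"
    have m: "m \<in> interior K"
      using 1 pq by (auto simp: m_def)
    obtain n1 where n1: "n1 \<noteq> 0" "\<And>y. y \<in> K \<Longrightarrow> n1 \<bullet> p \<le> n1 \<bullet> y" "n1 \<bullet> p < n1 \<bullet> m"
      using frontier_supporting_functional[OF K(2) closed K(3), of p] pq CK_eq m by metis
    obtain n2 where n2: "n2 \<noteq> 0" "\<And>y. y \<in> K \<Longrightarrow> n2 \<bullet> q \<le> n2 \<bullet> y" "n2 \<bullet> q < n2 \<bullet> m"
      using frontier_supporting_functional[OF K(2) closed K(3), of q] pq CK_eq m by metis
    have lt: "n1 \<bullet> p < n1 \<bullet> q" "n2 \<bullet> q < n2 \<bullet> p"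
      using n1(3) n2(3) by (simp_all add: m_def midpoint_def inner_add_right)
    show ?thesis
    proof (cases "n1 $ 1 * n2 $ 2 - n1 $ 2 * n2 $ 1 = 0")
      case True
      have par: "(n1 \<bullet> n1) *\<^sub>R n2 = (n1 \<bullet> n2) *\<^sub>R n1"
      proof -
        have "(n1 \<bullet> n1) * n2 $ 1 - (n1 \<bullet> n2) * n1 $ 1 = - n1 $ 2 * (n1 $ 1 * n2 $ 2 - n1 $ 2 * n2 $ 1)"
             "(n1 \<bullet> n1) * n2 $ 2 - (n1 \<bullet> n2) * n1 $ 2 = n1 $ 1 * (n1 $ 1 * n2 $ 2 - n1 $ 2 * n2 $ 1)"
          by (simp_all add: inner_real2 algebra_simps)
        then show ?thesis
          unfolding True by (simp add: vec_eq_iff forall_2)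
      qed
      have par': "(n1 \<bullet> n1) * (n2 \<bullet> y) = (n1 \<bullet> n2) * (n1 \<bullet> y)" for y
        using par by (metis inner_scaleR_left)
      have pos: "n1 \<bullet> n1 > 0"
        using n1(1) by simp
      \<comment> \<open>The parallel normals turn out to be opposite, so the supporting line at
        \<open>q\<close> bounds \<open>n1\<close> from above and the two lines enclose the
        curve.\<close>
      have "(n1 \<bullet> n2) * (n1 \<bullet> q - n1 \<bullet> p) = (n1 \<bullet> n1) * (n2 \<bullet> q - n2 \<bullet> p)"
        by (simp add: par' right_diff_distrib)
      also have "\<dots> < 0"
        using pos lt by (intro mult_pos_neg) auto
      finally have neg: "n1 \<bullet> n2 < 0"
        using lt by (simp add: mult_less_0_iff)
      have "n1 \<bullet> p \<le> n1 \<bullet> y \<and> n1 \<bullet> y \<le> n1 \<bullet> q" if "y \<in> C" for y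
      proof -
        have "(n1 \<bullet> n1) * (n2 \<bullet> q) \<le> (n1 \<bullet> n1) * (n2 \<bullet> y)"
          using n2(2)[of y] that CK pos by auto
        then have "n1 \<bullet> y \<le> n1 \<bullet> q"
          using neg by (simp add: par' mult_le_cancel_left_neg)
        then show ?thesis
          using n1(2)[of y] that CK by auto
      qed
      then have "curve_width C * norm n1 \<le> n1 \<bullet> q - n1 \<bullet> p"
        using pq n1(1) by (intro curve_width_le_strip) auto
      also have "\<dots> = n1 \<bullet> (q - p)"
        by (simp add: inner_diff_right)
      also have "\<dots> \<le> norm n1 * dist p q"
        using norm_cauchy_schwarz[of n1 "q - p"] by (simp add: dist_norm norm_minus_commute)
      finally have "curve_width C \<le> dist p q"
        using n1(1) by (simp add: mult.commute)
      then show ?thesis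
        by (smt (verit) zero_le_dist)
    next
      case False
      obtain z where z: "n1 \<bullet> z = n1 \<bullet> p" "n2 \<bullet> z = n2 \<bullet> q"
        using meeting_point[OF False] .
      interpret tangent_cone K z "p - z" "q - z" n1 n2
        by unfold_locales (use K CK_eq n1 n2 lt z pq 1 in \<open>auto simp: inner_diff_right\<close>)
      obtain x where x: "x \<in> C" "\<sigma> x + \<tau> x < 1"
        using frontier_near_apex CK_eq by blast
      \<comment> \<open>Here the halving enters: whichever arc contains \<open>x\<close> faces
        \<open>z\<close>, and equality of lengths transfers its bound to the other arc.\<close>
      have "path_length g1 \<le> norm (p - z) + norm (q - z)"
        using path_length_near_apex[of g1 x] path_length_near_apex[of g2 x] x g un len CK_eq by auto
      then have "dist p x + dist x q \<le> norm (p - z) + norm (q - z)" if "x \<in> C" for x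
        using sum_le[OF that] by (metis ereal_less_eq(3) order_trans)
      then show ?thesis
        using curve_width_le CK_eq by simp
    qed
  qed
qed

subsection \<open>Existence of halving pairs\<close>

locale convex_body_at_0 =
  fixes K :: "'a::euclidean_space set" and r R :: real
  assumes K: "convex K" "compact K" and r: "r > 0" "cball 0 r \<subseteq> K" and R: "R > 0" "K \<subseteq> cball 0 R"
begin

definition polar :: "'a set" where "polar = {u. \<forall>y\<in>K. u \<bullet> y \<le> 1}"

text \<open>The support function of the polar body is the Minkowski gauge of \<open>K\<close>.\<close>

definition minkowski_gauge :: "'a \<Rightarrow> real" where "minkowski_gauge x = (SUP u\<in>polar. u \<bullet> x)"

lemma zero_in_polar: "0 \<in> polar"
  by (simp add: polar_def)

lemma norm_polar_le:
  assumes "u \<in> polar"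
  shows "norm u \<le> 1 / r"
proof (cases "u = 0")
  case False
  have "(r / norm u) *\<^sub>R u \<in> K"
    using r False by (intro subsetD[OF r(2)]) auto
  then have "u \<bullet> ((r / norm u) *\<^sub>R u) \<le> 1"
    using assms by (auto simp: polar_def)
  moreover have "u \<bullet> ((r / norm u) *\<^sub>R u) = r * norm u"
    using False by (simp add: dot_square_norm power2_eq_square)
  ultimately show ?thesis
    using r by (simp add: field_simps)
qed (use r in auto)

lemma inner_polar_le:
  assumes "u \<in> polar"
  shows "u \<bullet> x \<le> norm x / r"
proof -
  have "u \<bullet> x \<le> norm u * norm x"
    by (rule norm_cauchy_schwarz)
  also have "\<dots> \<le> (1 / r) * norm x"
    by (intro mult_right_mono norm_polar_le assms) auto
  finally show ?thesis
    by simp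
qed

lemma inner_le_gauge: "u \<in> polar \<Longrightarrow> u \<bullet> x \<le> minkowski_gauge x"
  unfolding minkowski_gauge_def using inner_polar_le by (intro cSUP_upper bdd_aboveI2[of _ _ "norm x / r"])

lemma gauge_leI: "(\<And>u. u \<in> polar \<Longrightarrow> u \<bullet> x \<le> b) \<Longrightarrow> minkowski_gauge x \<le> b"
  unfolding minkowski_gauge_def using zero_in_polar by (intro cSUP_least) auto

text \<open>The gauge is a supremum of functionals of norm at most \<open>1 / r\<close>, hence
  Lipschitz with that constant.\<close>

lemma gauge_diff_le: "\<bar>minkowski_gauge x - minkowski_gauge y\<bar> \<le> norm (x - y) / r"
proof -
  have "minkowski_gauge x \<le> minkowski_gauge y + norm (x - y) / r" for x y
  proof (rule gauge_leI)
    fix u assume u: "u \<in> polar"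
    show "u \<bullet> x \<le> minkowski_gauge y + norm (x - y) / r"
      using inner_le_gauge[OF u, of y] inner_polar_le[OF u, of "x - y"] by (simp add: inner_diff_right)
  qed
  from this[of x y] this[of y x] show ?thesis
    by (simp add: norm_minus_commute abs_le_iff)
qed

lemma gauge_scaleR:
  assumes "t > 0"
  shows "minkowski_gauge (t *\<^sub>R x) = t * minkowski_gauge x"
proof -
  have *: "minkowski_gauge (t *\<^sub>R x) \<le> t * minkowski_gauge x" if "t > 0" for t x
    using that inner_le_gauge by (intro gauge_leI) auto
  from *[of t x] *[of "1 / t" "t *\<^sub>R x"] show ?thesis
    using assms by (simp add: field_simps)
qed

lemma gauge_lower: "norm x / R \<le> minkowski_gauge x"
proof (cases "x = 0")
  case True
  then show ?thesis
    using inner_le_gauge[OF zero_in_polar, of x] by simp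
next
  case False
  have "x \<bullet> y \<le> R * norm x" if "y \<in> K" for y
  proof -
    have "x \<bullet> y \<le> norm x * norm y"
      by (rule norm_cauchy_schwarz)
    also have "\<dots> \<le> norm x * R"
      using that R by (intro mult_left_mono) auto
    finally show ?thesis
      by (simp add: mult.commute)
  qed
  then have "x /\<^sub>R (R * norm x) \<in> polar"
    using R False by (auto simp: polar_def field_simps)
  from inner_le_gauge[OF this, of x] show ?thesis
    using R False by (simp add: dot_square_norm power2_eq_square field_simps)
qed

lemma interior_nonempty: "0 \<in> interior K"
  using r by (meson mem_interior_cball)

lemma gauge_le_1: "x \<in> K \<Longrightarrow> minkowski_gauge x \<le> 1"
  by (rule gauge_leI) (auto simp: polar_def)

text \<open>At a frontier point a normalized supporting functional is a polar element with value
  \<open>1\<close>. Conversely, a separating functional gives an outside point a value above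
  \<open>1\<close>, and an interior point could be enlarged within \<open>K\<close>.\<close>

lemma gauge_eq_1_iff: "minkowski_gauge x = 1 \<longleftrightarrow> x \<in> frontier K"
proof
  assume x: "x \<in> frontier K"
  obtain n where n: "\<And>y. y \<in> K \<Longrightarrow> n \<bullet> x \<le> n \<bullet> y" "\<And>y. y \<in> interior K \<Longrightarrow> n \<bullet> x < n \<bullet> y"
    using frontier_supporting_functional[of K x] K x interior_nonempty
    by (metis compact_imp_closed empty_iff)
  have neg: "n \<bullet> x < 0"
    using n(2)[OF interior_nonempty] by simp
  \<comment> \<open>Division by the negative number \<open>n \<bullet> x\<close> reverses the
    supporting inequality and turns it into the polar condition.\<close>
  then have "n /\<^sub>R (n \<bullet> x) \<in> polar"
    using n(1) by (auto simp: polar_def field_simps)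
  from inner_le_gauge[OF this, of x] have "1 \<le> minkowski_gauge x"
    using neg by simp
  moreover have "x \<in> K"
    using x K by (simp add: frontier_def compact_imp_closed)
  ultimately show "minkowski_gauge x = 1"
    using gauge_le_1 by force
next
  assume 1: "minkowski_gauge x = 1"
  have "x \<in> K"
  proof (rule ccontr)
    assume "x \<notin> K"
    then obtain a b where ab: "a \<bullet> x < b" "\<And>y. y \<in> K \<Longrightarrow> b < a \<bullet> y"
      using separating_hyperplane_closed_point K compact_imp_closed by metis
    have "b < 0"
      using ab(2)[of 0] interior_nonempty interior_subset by auto
    then have "a /\<^sub>R b \<in> polar"
      using ab(2) by (auto simp: polar_def field_simps less_imp_le)
    from inner_le_gauge[OF this, of x] show False
      using 1 ab(1) \<open>b < 0\<close> by (simp add: field_simps)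
  qed
  moreover have "x \<notin> interior K"
  proof
    assume "x \<in> interior K"
    then obtain e where e: "e > 0" "cball x e \<subseteq> K"
      by (meson mem_interior_cball)
    have "x \<noteq> 0"
      using 1 gauge_diff_le[of x 0] gauge_scaleR[of 2 0] by auto
    have "(1 + e / norm x) *\<^sub>R x \<in> K"
      using e \<open>x \<noteq> 0\<close> by (intro subsetD[OF e(2)]) (auto simp: dist_norm algebra_simps)
    then show False
      using gauge_le_1 gauge_scaleR[of "1 + e / norm x" x] 1 e \<open>x \<noteq> 0\<close>
      by (smt (verit) divide_pos_pos mult_cancel_left2 zero_less_norm_iff)
  qed
  ultimately show "x \<in> frontier K"
    using closure_subset by (auto simp: frontier_def)
qed

lemma gauge_pos: "x \<noteq> 0 \<Longrightarrow> minkowski_gauge x > 0"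
  using gauge_lower[of x] R by (smt (verit) divide_pos_pos zero_less_norm_iff)

text \<open>On unit vectors the reciprocal of the gauge is at most \<open>R\<close>. A difference of
  reciprocals contains the product of both, whence the term \<open>R\<^sup>2 / r\<close>.\<close>

lemma radial_projection_Lipschitz:
  assumes "norm x = 1" "norm y = 1"
  shows "dist (x /\<^sub>R minkowski_gauge x) (y /\<^sub>R minkowski_gauge y) \<le> (R + R\<^sup>2 / r) * dist x y"
proof -
  have pos: "minkowski_gauge x > 0" "minkowski_gauge y > 0"
    using assms by (metis gauge_pos norm_zero zero_neq_one)+
  have inv: "inverse (minkowski_gauge x) \<le> R" "inverse (minkowski_gauge y) \<le> R"
    using gauge_lower[of x] gauge_lower[of y] assms R pos by (simp_all add: field_simps)
  have "norm (inverse (minkowski_gauge x) *\<^sub>R (x - y)) \<le> R * norm (x - y)"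
    using inv pos by (simp add: mult_right_mono)
  moreover have "norm ((inverse (minkowski_gauge x) - inverse (minkowski_gauge y)) *\<^sub>R y) \<le> R * R * (norm (x - y) / r)"
  proof -
    have "inverse (minkowski_gauge x) - inverse (minkowski_gauge y)
        = (inverse (minkowski_gauge x) * inverse (minkowski_gauge y)) * (minkowski_gauge y - minkowski_gauge x)"
      using pos by (simp add: field_simps)
    then have "\<bar>inverse (minkowski_gauge x) - inverse (minkowski_gauge y)\<bar>
        = (inverse (minkowski_gauge x) * inverse (minkowski_gauge y)) * \<bar>minkowski_gauge x - minkowski_gauge y\<bar>"
      using pos by (simp add: abs_mult abs_minus_commute)
    also have "\<dots> \<le> R * R * (norm (x - y) / r)"
      using inv pos R by (intro mult_mono gauge_diff_le) auto
    finally show ?thesis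
      using assms by simp
  qed
  moreover have "x /\<^sub>R minkowski_gauge x - y /\<^sub>R minkowski_gauge y
      = inverse (minkowski_gauge x) *\<^sub>R (x - y) + (inverse (minkowski_gauge x) - inverse (minkowski_gauge y)) *\<^sub>R y"
    by (simp add: algebra_simps)
  ultimately show ?thesis
    using norm_triangle_ineq[of "inverse (minkowski_gauge x) *\<^sub>R (x - y)" "(inverse (minkowski_gauge x) - inverse (minkowski_gauge y)) *\<^sub>R y"]
    by (simp add: dist_norm power2_eq_square algebra_simps)
qed

end

section \<open>Lipschitz parametrization of a closed convex curve by the angle\<close>

definition unit_circle_path :: "real \<Rightarrow> real^2" where
  "unit_circle_path t = vector [cos (2 * pi * t), sin (2 * pi * t)]"

lemma norm_unit_circle_path [simp]: "norm (unit_circle_path t) = 1"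
  by (simp add: norm_eq_sqrt_inner inner_real2 unit_circle_path_def flip: power2_eq_square)

lemma unit_circle_path_nonzero [simp]: "unit_circle_path t \<noteq> 0"
  by (metis norm_unit_circle_path norm_zero zero_neq_one)

lemma unit_circle_path_0_1: "unit_circle_path 0 = unit_circle_path 1"
  by (simp add: unit_circle_path_def)

text \<open>Each coordinate is Lipschitz with constant \<open>2 * pi\<close>; the norm is bounded by
  the sum of the absolute coordinates, which doubles it.\<close>

lemma unit_circle_path_Lipschitz:
  "dist (unit_circle_path s) (unit_circle_path t) \<le> 4 * pi * dist s t"
proof -
  have *: "\<bar>sin ((a - b) / 2)\<bar> \<le> \<bar>a - b\<bar> / 2" for a b :: real
    using abs_sin_x_le_abs_x[of "(a - b) / 2"] by simp
  have c: "\<bar>cos a - cos b\<bar> \<le> \<bar>a - b\<bar>" for a b :: real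
  proof -
    have "\<bar>cos a - cos b\<bar> = 2 * \<bar>sin ((a + b) / 2)\<bar> * \<bar>sin ((b - a) / 2)\<bar>"
      unfolding cos_diff_cos by (simp add: abs_mult)
    also have "\<dots> \<le> 2 * 1 * (\<bar>b - a\<bar> / 2)"
      by (intro mult_mono *) (auto simp: abs_sin_le_one)
    finally show ?thesis
      by simp
  qed
  have s: "\<bar>sin a - sin b\<bar> \<le> \<bar>a - b\<bar>" for a b :: real
  proof -
    have "\<bar>sin a - sin b\<bar> = 2 * \<bar>sin ((a - b) / 2)\<bar> * \<bar>cos ((a + b) / 2)\<bar>"
      unfolding sin_diff_sin by (simp add: abs_mult)
    also have "\<dots> \<le> 2 * (\<bar>a - b\<bar> / 2) * 1"
      by (intro mult_mono *) (auto simp: abs_cos_le_one)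
    finally show ?thesis
      by simp
  qed
  have "dist (unit_circle_path s) (unit_circle_path t)
      \<le> (\<Sum>i\<in>UNIV. \<bar>(unit_circle_path s - unit_circle_path t) $ i\<bar>)"
    unfolding dist_norm by (rule norm_le_l1_cart)
  also have "\<dots> \<le> \<bar>2 * pi * s - 2 * pi * t\<bar> + \<bar>2 * pi * s - 2 * pi * t\<bar>"
    unfolding sum_2 by (intro add_mono) (auto simp: unit_circle_path_def c s)
  also have "\<dots> = 4 * pi * dist s t"
    by (simp add: dist_real_def abs_mult flip: right_diff_distrib)
  finally show ?thesis .
qed

lemma unit_circle_path_eqD:
  assumes "unit_circle_path s = unit_circle_path t" "s \<in> {0..1}" "t \<in> {0..1}"
  shows "s = t \<or> s = 0 \<and> t = 1 \<or> s = 1 \<and> t = 0"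
proof -
  have "cos (2 * pi * s) = cos (2 * pi * t)" "sin (2 * pi * s) = sin (2 * pi * t)"
    using arg_cong[OF assms(1), of "\<lambda>v. v $ 1"] arg_cong[OF assms(1), of "\<lambda>v. v $ 2"]
    by (simp_all add: unit_circle_path_def)
  then obtain k :: int where "2 * pi * s = 2 * pi * t + 2 * pi * k"
    using sin_cos_eq_iff by blast
  then have "2 * pi * (s - t - k) = 0"
    by (simp add: algebra_simps)
  then have st: "s - t = of_int k"
    by simp
  then have "real_of_int k < 2" "-2 < real_of_int k"
    using assms(2,3) by auto
  then have "k \<in> {-1, 0, 1}"
    by auto
  then show ?thesis
    using st assms(2,3) by auto
qed

lemma unit_circle_path_surj:
  assumes "norm x = 1"
  obtains t where "t \<in> {0..1}" "x = unit_circle_path t"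
proof -
  have "(x $ 1)\<^sup>2 + (x $ 2)\<^sup>2 = 1"
    using assms by (simp add: norm_eq_sqrt_inner inner_real2 power2_eq_square)
  then obtain a where a: "0 \<le> a" "a < 2 * pi" "x $ 1 = cos a" "x $ 2 = sin a"
    using sincos_total_2pi by metis
  show ?thesis
  proof (rule that[of "a / (2 * pi)"])
    show "x = unit_circle_path (a / (2 * pi))"
      using a by (simp add: unit_circle_path_def vec_eq_iff forall_2)
  qed (use a in \<open>simp add: field_simps\<close>)
qed

text \<open>The circle is projected radially from an interior point. The Lipschitz bound will make
  partial lengths finite and continuous in the parameter.\<close>

lemma convex_curve_Lipschitz_parametrization:
  assumes "closed_convex_curve C"
  obtains \<gamma> L where "simple_path \<gamma>" "pathfinish \<gamma> = pathstart \<gamma>" "path_image \<gamma> = C"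
    "L-lipschitz_on {0..1} \<gamma>"
proof -
  obtain K where K: "compact K" "convex K" "interior K \<noteq> {}" and CK: "C = frontier K"
    using assms by (auto simp: closed_convex_curve_def)
  then obtain c r where r: "r > 0" "cball c r \<subseteq> K"
    by (meson ex_in_conv mem_interior_cball)
  define K' where "K' = (\<lambda>x. x - c) ` K"
  have "bounded K'"
    using K(1) compact_translation_subtract[of K c] by (simp add: K'_def compact_imp_bounded)
  then obtain R where R: "R > 0" "K' \<subseteq> cball 0 R"
    by (auto simp: bounded_pos subset_eq)
  have "cball 0 r \<subseteq> K'"
  proof
    fix x :: "real^2" assume "x \<in> cball 0 r"
    then have "x + c \<in> K"
      using r by (auto simp: dist_norm)
    then show "x \<in> K'"
      unfolding K'_def by (intro image_eqI[of _ _ "x + c"]) auto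
  qed
  then interpret convex_body_at_0 K' r R
    using K r R compact_translation_subtract[of K c] convex_translation_subtract[of K c]
    by unfold_locales (auto simp: K'_def)
  have C: "C = (+) c ` frontier K'"
  proof -
    have "K = (+) c ` K'"
      by (simp add: K'_def image_image)
    then show ?thesis
      using CK frontier_translation[of c K'] by simp
  qed
  define v where "v = unit_circle_path"
  define \<gamma> where "\<gamma> t = c + v t /\<^sub>R minkowski_gauge (v t)" for t
  have lip: "((R + R\<^sup>2 / r) * (4 * pi))-lipschitz_on {0..1} \<gamma>"
  proof (rule lipschitz_onI)
    fix s t :: real
    have "dist (\<gamma> s) (\<gamma> t) \<le> (R + R\<^sup>2 / r) * dist (v s) (v t)"
      unfolding \<gamma>_def v_def using radial_projection_Lipschitz by simp
    also have "\<dots> \<le> (R + R\<^sup>2 / r) * (4 * pi * dist s t)"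
      using unit_circle_path_Lipschitz R r by (intro mult_left_mono) (auto simp: v_def)
    finally show "dist (\<gamma> s) (\<gamma> t) \<le> (R + R\<^sup>2 / r) * (4 * pi) * dist s t"
      by (simp add: mult_ac)
  qed (use R r in auto)
  have closed: "pathfinish \<gamma> = pathstart \<gamma>"
    by (simp add: pathfinish_def pathstart_def \<gamma>_def v_def unit_circle_path_0_1)
  have inj: "v s = v t" if "\<gamma> s = \<gamma> t" for s t
  proof -
    have eq: "v s /\<^sub>R minkowski_gauge (v s) = v t /\<^sub>R minkowski_gauge (v t)"
      using that by (simp add: \<gamma>_def)
    have pos: "minkowski_gauge (v s) > 0" "minkowski_gauge (v t) > 0"
      using gauge_pos by (auto simp: v_def)
    \<comment> \<open>The \<open>v\<close> are unit vectors, so the norm of each side is the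
      reciprocal of its gauge value.\<close>
    from arg_cong[OF eq, of norm] have "minkowski_gauge (v s) = minkowski_gauge (v t)"
      using pos by (simp add: v_def)
    with eq pos show ?thesis
      by simp
  qed
  have simple: "simple_path \<gamma>"
    unfolding simple_path_def loop_free_def path_def
  proof (intro conjI ballI impI)
    show "continuous_on {0..1} \<gamma>"
      using lip by (rule lipschitz_on_continuous_on)
    fix s t :: real assume "s \<in> {0..1}" "t \<in> {0..1}" "\<gamma> s = \<gamma> t"
    then show "s = t \<or> s = 0 \<and> t = 1 \<or> s = 1 \<and> t = 0"
      using unit_circle_path_eqD[of s t] inj[of s t] unfolding v_def by blast
  qed
  have "path_image \<gamma> = C"
  proof
    have "minkowski_gauge (v t /\<^sub>R minkowski_gauge (v t)) = 1" for t
    proof -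
      have "minkowski_gauge (v t) > 0"
        using gauge_pos by (auto simp: v_def)
      then show ?thesis
        using gauge_scaleR[of "inverse (minkowski_gauge (v t))" "v t"] by simp
    qed
    then have "\<gamma> t \<in> C" for t
      unfolding C \<gamma>_def using gauge_eq_1_iff by (intro imageI) simp
    then show "path_image \<gamma> \<subseteq> C"
      unfolding path_image_def by blast
    show "C \<subseteq> path_image \<gamma>"
    proof
      fix y assume "y \<in> C"
      then obtain x where "y = c + x" "x \<in> frontier K'"
        unfolding C by (elim imageE)
      then have x: "y = c + x" "minkowski_gauge x = 1"
        using gauge_eq_1_iff[of x] by simp_all
      have "x \<noteq> 0"
        using x(2) gauge_scaleR[of 2 0] by auto
      then obtain t where t: "t \<in> {0..1}" "x /\<^sub>R norm x = v t"
        using unit_circle_path_surj[of "x /\<^sub>R norm x"] by (auto simp: v_def)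
      have "minkowski_gauge (v t) = inverse (norm x)"
        using gauge_scaleR[of "inverse (norm x)" x] x(2) \<open>x \<noteq> 0\<close> by (simp flip: t(2))
      then have "y = \<gamma> t"
        using \<open>x \<noteq> 0\<close> by (simp add: \<gamma>_def x(1) flip: t(2))
      then show "y \<in> path_image \<gamma>"
        using t(1) by (auto simp: path_image_def)
    qed
  qed
  then show ?thesis
    using that simple closed lip by blast
qed

text \<open>Without this lemma \<open>min_halving_distance C\<close> could be the junk value \<open>Inf {}\<close>.\<close>

lemma halving_pair_exists:
  assumes "closed_convex_curve C"
  shows "\<exists>p q. halving_pair C p q"
proof -
  obtain \<gamma> L where \<gamma>: "simple_path \<gamma>" "pathfinish \<gamma> = pathstart \<gamma>" "path_image \<gamma> = C"
      and lip: "L-lipschitz_on {0..1} \<gamma>"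
    using convex_curve_Lipschitz_parametrization[OF assms] .
  have L: "L \<ge> 0"
    using lip by (rule lipschitz_on_nonneg)
  \<comment> \<open>The Lipschitz bound makes partial lengths on \<open>{0..1}\<close> finite, so
    real values represent them faithfully and the intermediate value theorem applies.\<close>
  define F where "F s t = real_of_ereal (length_on \<gamma> s t)" for s t
  have le: "length_on \<gamma> s t \<le> ereal (L * (t - s))" if "0 \<le> s" "s \<le> t" "t \<le> 1" for s t
    using that by (intro length_on_le_Lipschitz lipschitz_on_subset[OF lip]) auto
  have F: "length_on \<gamma> s t = ereal (F s t)" if "0 \<le> s" "s \<le> t" "t \<le> 1" for s t
    using le[OF that] length_on_nonneg[of \<gamma> s t] unfolding F_def
    by (cases "length_on \<gamma> s t") auto
  have F_le: "F s t \<le> L * (t - s)" "0 \<le> F s t" if "0 \<le> s" "s \<le> t" "t \<le> 1" for s t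
    using le[OF that] length_on_nonneg[of \<gamma> s t] unfolding F[OF that] by auto
  have F_add: "F s u = F s t + F t u" if "0 \<le> s" "s \<le> t" "t \<le> u" "u \<le> 1" for s t u
    using length_on_add[of s t u \<gamma>] F[of s u] F[of s t] F[of t u] that by simp
  have "L-lipschitz_on {0..1} (F 0)"
  proof (rule lipschitz_onI)
    fix s t :: real assume st: "s \<in> {0..1}" "t \<in> {0..1}"
    have "\<bar>F 0 s - F 0 t\<bar> \<le> L * \<bar>s - t\<bar>"
    proof (cases "s \<le> t")
      case True
      then show ?thesis
        using F_add[of 0 s t] F_le[of s t] st by auto
    next
      case False
      then show ?thesis
        using F_add[of 0 t s] F_le[of t s] st by auto
    qed
    then show "dist (F 0 s) (F 0 t) \<le> L * dist s t"
      by (simp add: dist_real_def)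
  qed (rule L)
  then have "continuous_on {0..1} (F 0)"
    by (rule lipschitz_on_continuous_on)
  moreover have "F 0 0 = 0"
    using F_le[of 0 0] by simp
  moreover have F01: "F 0 1 \<ge> 0"
    using F_le[of 0 1] by simp
  ultimately obtain t where t: "0 \<le> t" "t \<le> 1" "F 0 t = F 0 1 / 2"
    using IVT'[of "F 0" 0 "F 0 1 / 2" 1] by auto
  \<comment> \<open>Positive total length keeps the bisecting parameter \<open>t\<close> away from
    \<open>0\<close> and \<open>1\<close>, so both pieces are genuine arcs.\<close>
  have pos: "F 0 1 > 0"
  proof -
    have "\<gamma> 0 \<noteq> \<gamma> (1/2)"
    proof
      assume "\<gamma> 0 = \<gamma> (1/2)"
      moreover have "0 \<in> {0..1::real}" "1/2 \<in> {0..1::real}"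
        by auto
      ultimately have "(0::real) = 1/2 \<or> (0::real) = 0 \<and> (1/2::real) = 1 \<or> (0::real) = 1 \<and> (1/2::real) = 0"
        using \<gamma>(1) unfolding simple_path_def loop_free_def by blast
      then show False
        by simp
    qed
    then have "0 < dist (\<gamma> 0) (\<gamma> (1/2))"
      by simp
    also have "\<dots> \<le> F 0 (1/2)"
      using dist_le_length_on[of 0 "1/2" \<gamma>] F[of 0 "1/2"] by simp
    also have "\<dots> \<le> F 0 1"
      using F_add[of 0 "1/2" 1] F_le[of "1/2" 1] by simp
    finally show ?thesis .
  qed
  have t': "0 < t" "t < 1"
    using t pos \<open>F 0 0 = 0\<close> by (auto simp: less_le)
  have "F 0 t = F t 1"
    using F_add[of 0 t 1] t by simp
  then have len: "path_length (subpath 0 t \<gamma>) = path_length (subpath t 1 \<gamma>)"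
    using F[of 0 t] F[of t 1] t t' by (simp add: path_length_subpath)
  have ends: "\<gamma> 0 = \<gamma> 1"
    using \<gamma>(2) by (simp add: pathfinish_def pathstart_def)
  have un: "\<gamma> ` {0..t} \<union> \<gamma> ` {t..1} = C"
    unfolding image_Un[symmetric] \<gamma>(3)[symmetric] path_image_def
    using t' by (simp add: ivl_disj_un_two_touch)
  have int: "\<gamma> ` {0..t} \<inter> \<gamma> ` {t..1} = {\<gamma> 0, \<gamma> t}"
  proof
    show "\<gamma> ` {0..t} \<inter> \<gamma> ` {t..1} \<subseteq> {\<gamma> 0, \<gamma> t}"
    proof
      fix y assume "y \<in> \<gamma> ` {0..t} \<inter> \<gamma> ` {t..1}"
      then obtain a b where ab: "a \<in> {0..t}" "b \<in> {t..1}" "y = \<gamma> a" "y = \<gamma> b"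
        by blast
      then have "a = b \<or> a = 0 \<and> b = 1 \<or> a = 1 \<and> b = 0"
        using \<gamma>(1) t' by (fastforce simp: simple_path_def loop_free_def)
      then show "y \<in> {\<gamma> 0, \<gamma> t}"
        using ab t' by auto
    qed
    show "{\<gamma> 0, \<gamma> t} \<subseteq> \<gamma> ` {0..t} \<inter> \<gamma> ` {t..1}"
      using t' ends by (auto simp: image_iff intro: bexI[of _ 0] bexI[of _ 1] bexI[of _ t])
  qed
  have "halving_pair C (\<gamma> 0) (\<gamma> t)"
    unfolding halving_pair_def
    using \<gamma>(1) t' ends un int len
    by (intro exI[of _ "subpath 0 t \<gamma>"] exI[of _ "subpath t 1 \<gamma>"])
      (auto simp: path_image_subpath intro!: arc_simple_path_subpath_interior)
  then show ?thesis
    by blast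
qed

subsection \<open>Tightness\<close>

text \<open>The triangle with apex \<open>(0, H)\<close> and base from \<open>(-1, 0)\<close> to \<open>(1, 0)\<close>; a leg is parametrized by
  the fraction of the distance from the apex, so \<open>left 0 = right 0\<close> is the apex.\<close>

locale isosceles_triangle =
  fixes H :: real
  assumes H: "H > 0"
begin

definition left :: "real \<Rightarrow> real^2" where "left f = vector [- f, (1 - f) * H]"
definition right :: "real \<Rightarrow> real^2" where "right f = vector [f, (1 - f) * H]"
definition base :: "real \<Rightarrow> real^2" where "base x = vector [x, 0]"
definition leg :: real where "leg = sqrt (1 + H\<^sup>2)"
definition triangle :: "(real^2) set" where "triangle = frontier (convex hull {left 0, left 1, right 1})"

lemma corners: "right 0 = left 0" "base (-1) = left 1" "base 1 = right 1"
  by (simp_all add: left_def right_def base_def)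

lemma eq_iff:
  "left f = left g \<longleftrightarrow> f = g" "right f = right g \<longleftrightarrow> f = g" "base f = base g \<longleftrightarrow> f = g"
  "left f = right g \<longleftrightarrow> f = 0 \<and> g = 0" "right f = left g \<longleftrightarrow> f = 0 \<and> g = 0"
  "left f = base g \<longleftrightarrow> f = 1 \<and> g = -1" "base g = left f \<longleftrightarrow> f = 1 \<and> g = -1"
  "right f = base g \<longleftrightarrow> f = 1 \<and> g = 1" "base g = right f \<longleftrightarrow> f = 1 \<and> g = 1"
  using H by (auto simp: left_def right_def base_def vec_eq_iff forall_2)

lemma segments:
  "closed_segment (left a) (left b) = left ` closed_segment a b"
  "closed_segment (right a) (right b) = right ` closed_segment a b"
  "closed_segment (base a) (base b) = base ` closed_segment a b"
proof -
  have *: "closed_segment (h a) (h b) = h ` closed_segment a b"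
    if "\<And>u. h ((1 - u) *\<^sub>R a + u *\<^sub>R b) = (1 - u) *\<^sub>R h a + u *\<^sub>R h b" for h :: "real \<Rightarrow> real^2"
    unfolding closed_segment_def by (auto simp flip: that)
  show "closed_segment (left a) (left b) = left ` closed_segment a b"
    "closed_segment (right a) (right b) = right ` closed_segment a b"
    "closed_segment (base a) (base b) = base ` closed_segment a b"
    by (rule *, simp add: left_def right_def base_def vec_eq_iff forall_2 algebra_simps)+
qed

lemma dists:
  "dist (left a) (left b) = \<bar>a - b\<bar> * leg"
  "dist (right a) (right b) = \<bar>a - b\<bar> * leg"
  "dist (base a) (base b) = \<bar>a - b\<bar>"
proof -
  have "(a - b)\<^sup>2 + ((1 - a) * H - (1 - b) * H)\<^sup>2 = (a - b)\<^sup>2 * (1 + H\<^sup>2)"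
    by (simp add: power2_eq_square algebra_simps)
  then show "dist (left a) (left b) = \<bar>a - b\<bar> * leg" "dist (right a) (right b) = \<bar>a - b\<bar> * leg"
    by (simp_all add: dist_norm norm_eq_sqrt_inner inner_real2 left_def right_def leg_def
        real_sqrt_mult power2_commute[of b a] flip: power2_eq_square)
  show "dist (base a) (base b) = \<bar>a - b\<bar>"
    by (simp add: dist_norm norm_eq_sqrt_inner inner_real2 base_def flip: power2_eq_square)
qed

lemma leg: "leg > 1" "leg > H"
proof -
  show "leg > 1"
    using H by (simp add: leg_def)
  show "leg > H"
    unfolding leg_def by (rule real_less_rsqrt) simp
qed

lemma triangle_eq: "triangle = left ` {0..1} \<union> base ` {-1..1} \<union> right ` {0..1}"
proof -
  have "triangle = closed_segment (left 0) (left 1) \<union> closed_segment (base (-1)) (base 1) \<union>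
      closed_segment (right 1) (right 0)"
    unfolding triangle_def corners by (rule frontier_of_triangle) simp
  then show ?thesis
    unfolding segments by (simp add: closed_segment_eq_real_ivl)
qed

lemma closed_convex_curve_triangle: "closed_convex_curve triangle"
proof -
  let ?K = "convex hull {left 0, left 1, right 1}"
  have "interior ?K \<noteq> {}"
  proof
    assume "interior ?K = {}"
    then obtain n b where n: "n \<noteq> 0" "?K \<subseteq> {x. n \<bullet> x = b}"
      using empty_interior_subset_hyperplane[of ?K] convex_convex_hull by blast
    then have "n \<bullet> left 0 = b" "n \<bullet> left 1 = b" "n \<bullet> right 1 = b"
      by (auto simp: hull_inc subset_eq)
    then have "n = 0"
      using H by (auto simp: inner_real2 left_def right_def vec_eq_iff forall_2)
    then show False
      using n by simp
  qed
  moreover have "compact ?K"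
    by (simp add: finite_imp_compact_convex_hull)
  ultimately show ?thesis
    unfolding closed_convex_curve_def triangle_def using convex_convex_hull by blast
qed

text \<open>Chosen so that the path over the apex between the points at fraction
  \<open>\<mu>\<close> on the legs has length \<open>2 * \<mu> * leg = leg + 1\<close>, half the
  perimeter.\<close>

definition \<mu> :: real where "\<mu> = 1 / 2 + 1 / (2 * leg)"

lemma \<mu>_bounds: "1/2 < \<mu>" "\<mu> < 1" "2 * \<mu> * leg = leg + 1"
  using leg by (simp_all add: \<mu>_def field_simps)

lemma halving_pair_triangle: "halving_pair triangle (left \<mu>) (right \<mu>)"
proof -
  \<comment> \<open>\<open>g1\<close> runs over the apex, where \<open>left 0\<close> and
    \<open>right 0\<close> coincide; \<open>g2\<close> returns along the base.\<close>
  define g1 where "g1 = linepath (left \<mu>) (left 0) +++ linepath (right 0) (right \<mu>)"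
  define g2 where "g2 = linepath (right \<mu>) (right 1) +++
      (linepath (base 1) (base (-1)) +++ linepath (left 1) (left \<mu>))"
  note ci = closed_segment_eq_real_ivl
  have img0: "path_image (linepath (base 1) (base (-1)) +++ linepath (left 1) (left \<mu>))
      = base ` {-1..1} \<union> left ` {\<mu>..1}"
    using \<mu>_bounds by (simp add: path_image_join eq_iff segments ci)
  have img1: "path_image g1 = left ` {0..\<mu>} \<union> right ` {0..\<mu>}"
    using \<mu>_bounds by (simp add: g1_def path_image_join eq_iff segments ci)
  have img2: "path_image g2 = right ` {\<mu>..1} \<union> (base ` {-1..1} \<union> left ` {\<mu>..1})"
    using \<mu>_bounds by (simp add: g2_def path_image_join img0 eq_iff segments ci)
  have "arc g1"
    unfolding g1_def using \<mu>_bounds by (intro arc_join) (auto simp: eq_iff segments ci)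
  moreover have "arc (linepath (base 1) (base (-1)) +++ linepath (left 1) (left \<mu>))"
    using \<mu>_bounds by (intro arc_join) (auto simp: eq_iff segments ci)
  then have "arc g2"
    unfolding g2_def using \<mu>_bounds by (intro arc_join) (auto simp: img0 eq_iff segments ci)
  moreover have "path_image g1 \<union> path_image g2 = triangle"
  proof -
    have "{0..1} = {0..\<mu>} \<union> {\<mu>..1}"
      using \<mu>_bounds by auto
    then show ?thesis
      unfolding img1 img2 triangle_eq image_Un by auto
  qed
  moreover have "path_image g1 \<inter> path_image g2 = {left \<mu>, right \<mu>}"
    unfolding img1 img2 using \<mu>_bounds by (auto simp: eq_iff)
  moreover have "path_length g1 = path_length g2"
  proof -
    have "path_length g1 = ereal (2 * \<mu> * leg)"
      using \<mu>_bounds by (simp add: g1_def path_length_join eq_iff path_length_linepath dists)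
    moreover have "path_length g2 = ereal (2 * leg + 2 - 2 * \<mu> * leg)"
      using \<mu>_bounds by (simp add: g2_def path_length_join eq_iff path_length_linepath dists algebra_simps)
    ultimately show ?thesis
      using \<mu>_bounds(3) by simp
  qed
  moreover have "pathstart g1 = left \<mu>" "pathfinish g1 = right \<mu>"
    "pathstart g2 = right \<mu>" "pathfinish g2 = left \<mu>"
    by (simp_all add: g1_def g2_def)
  ultimately show ?thesis
    unfolding halving_pair_def by blast
qed

text \<open>The horizontal halving pair has distance \<open>2 * \<mu> = 1 + 1 / leg\<close>, and
  \<open>leg > H\<close>.\<close>

lemma min_halving_distance_triangle: "min_halving_distance triangle \<le> 1 + 1 / H"
proof -
  have "min_halving_distance triangle \<le> dist (left \<mu>) (right \<mu>)"
    unfolding min_halving_distance_def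
    using halving_pair_triangle by (intro cInf_lower bdd_belowI[of _ 0]) auto
  also have "\<dots> = 2 * \<mu>"
  proof -
    have "(left \<mu> - right \<mu>) \<bullet> (left \<mu> - right \<mu>) = (2 * \<mu>)\<^sup>2"
      by (simp add: inner_real2 left_def right_def power2_eq_square)
    then show ?thesis
      using real_sqrt_unique[OF refl, of "2 * \<mu>"] \<mu>_bounds by (simp only: dist_norm norm_eq_sqrt_inner)
  qed
  also have "\<dots> \<le> 1 + 1 / H"
    using leg H by (simp add: \<mu>_def frac_le)
  finally show ?thesis .
qed

text \<open>In a strip of width \<open>w\<close> the base bounds the first component of the unit
  normal by \<open>w / 2\<close> and the apex bounds the second by \<open>w / H\<close>; their
  absolute values sum to at least \<open>1\<close>. The resulting lower bound tends to
  \<open>2\<close> as \<open>H\<close> grows.\<close>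

lemma curve_width_triangle: "1 \<le> curve_width triangle * (1 / 2 + 1 / H)"
proof -
  have corner: "left 0 \<in> triangle" "left 1 \<in> triangle" "right 1 \<in> triangle"
    by (auto simp: triangle_eq)
  have "1 / (1 / 2 + 1 / H) \<le> curve_width triangle"
    unfolding curve_width_def
  proof (rule cInf_greatest)
    \<comment> \<open>Boundedness supplies one enclosing strip, so the infimum is taken over a
      nonempty set.\<close>
    have "bounded triangle"
      unfolding triangle_def by (intro compact_imp_bounded compact_frontier) (simp add: finite_imp_compact_convex_hull)
    then obtain r where r: "\<And>x. x \<in> triangle \<Longrightarrow> norm x \<le> r"
      by (auto simp: bounded_iff)
    have "\<bar>axis 1 1 \<bullet> x\<bar> \<le> r" if "x \<in> triangle" for x :: "real^2"
      using r[OF that] component_le_norm_cart[of x 1] by (simp add: inner_axis')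
    then have "triangle \<subseteq> {x. - r \<le> axis 1 1 \<bullet> x \<and> axis 1 1 \<bullet> x \<le> r}"
      by (force simp: abs_le_iff)
    then show "{b - a |u a b. norm u = 1 \<and> triangle \<subseteq> {x. a \<le> u \<bullet> x \<and> u \<bullet> x \<le> b}} \<noteq> {}"
      using norm_axis_1 by blast
  next
    fix w assume "w \<in> {b - a |u a b. norm u = 1 \<and> triangle \<subseteq> {x. a \<le> u \<bullet> x \<and> u \<bullet> x \<le> b}}"
    then obtain u a b where u: "w = b - a" "norm u = 1" "triangle \<subseteq> {x. a \<le> u \<bullet> x \<and> u \<bullet> x \<le> b}"
      by blast
    then have "a \<le> u \<bullet> left 0" "u \<bullet> left 0 \<le> b" "a \<le> u \<bullet> left 1" "u \<bullet> left 1 \<le> b"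
      "a \<le> u \<bullet> right 1" "u \<bullet> right 1 \<le> b"
      using corner by blast+
    then have "2 * \<bar>u $ 1\<bar> \<le> w" "H * \<bar>u $ 2\<bar> \<le> w"
      using H unfolding u(1) by (auto simp: inner_real2 left_def right_def abs_if mult.commute)
    then have "\<bar>u $ 1\<bar> + \<bar>u $ 2\<bar> \<le> w * (1 / 2 + 1 / H)"
    proof -
      have "\<bar>u $ 2\<bar> \<le> w / H"
        using \<open>H * \<bar>u $ 2\<bar> \<le> w\<close> H by (simp add: field_simps)
      then show ?thesis
        using \<open>2 * \<bar>u $ 1\<bar> \<le> w\<close> by (simp add: distrib_left)
    qed
    moreover have "1 \<le> \<bar>u $ 1\<bar> + \<bar>u $ 2\<bar>"
      using norm_le_l1_cart[of u] u(2) by (simp add: sum_2)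
    ultimately have "1 \<le> w * (1 / 2 + 1 / H)"
      by linarith
    moreover have "0 < 1 / 2 + 1 / H"
      using H by (simp add: add_pos_pos)
    ultimately show "1 / (1 / 2 + 1 / H) \<le> w"
      by (simp add: pos_divide_le_eq)
  qed
  then show ?thesis
    using H by (simp add: field_simps)
qed

end

theorem theorem8:
  shows "(\<forall>C. closed_convex_curve C \<longrightarrow> min_halving_distance C \<ge> 1/2 * curve_width C) \<and>
         (\<forall>c>1/2. \<not> (\<forall>C. closed_convex_curve C \<longrightarrow> min_halving_distance C \<ge> c * curve_width C))"
proof (intro conjI allI impI notI)
  fix C assume C: "closed_convex_curve C"
  then show "min_halving_distance C \<ge> 1/2 * curve_width C"
    unfolding min_halving_distance_def
    using halving_pair_exists[OF C] curve_width_le_halving_pair[OF C]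
    by (intro cInf_greatest) force+
next
  fix c :: real
  assume c: "c > 1/2" and all: "\<forall>C. closed_convex_curve C \<longrightarrow> min_halving_distance C \<ge> c * curve_width C"
  \<comment> \<open>Large enough that \<open>e = 1 / H\<close> satisfies
    \<open>3 * e < c - 1/2\<close>, while the estimates below give at most
    \<open>c - 1/2 \<le> 5/2 * e\<close>.\<close>
  define H where "H = 1 + 3 / (c - 1/2)"
  have "H * (c - 1/2) = (c - 1/2) + 3"
    using c by (simp add: H_def distrib_right del: right_diff_distrib_numeral)
  then have H_gt: "H > 1" "3 < H * (c - 1/2)"
    using c by (simp_all add: H_def)
  interpret isosceles_triangle H
    by unfold_locales (use H_gt in auto)
  define e where "e = 1 / H"
  have e: "0 < e" "e < 1" "3 * e < c - 1/2"
    using H_gt by (simp_all add: e_def pos_divide_less_eq mult.commute)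
  have "c \<le> c * (curve_width triangle * (1/2 + e))"
    using curve_width_triangle c by (simp add: e_def)
  also have "\<dots> = (c * curve_width triangle) * (1/2 + e)"
    by simp
  \<comment> \<open>The assumed inequality for \<open>c\<close> is applied to the triangle, whose
    minimum halving distance is at most \<open>1 + e\<close>.\<close>
  also have "\<dots> \<le> (1 + e) * (1/2 + e)"
    using all closed_convex_curve_triangle min_halving_distance_triangle e
    by (intro mult_right_mono) (auto simp: e_def intro: order_trans)
  also have "\<dots> = 1/2 + 3/2 * e + e * e"
    by (simp add: field_simps)
  also have "\<dots> \<le> 1/2 + 3/2 * e + e"
    using mult_left_le[of e e] e by simp
  finally show False
    using e by simp
qed

end
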